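(* Every extremal tree is either a balanced tree of stars or a path with an odd number of edges.
   Context: All graphs are finite, simple, undirected. For a graph $G$, $F(G)$ denotes the number of stable (independent) sets of $G$, including the empty set, and $\alpha(G)$ is the stability number. A tree $T$ is extremal if $F(T)$ is minimum among all trees with $|V(T)|$ vertices and stability number $\alpha(T)$. A leaf of a tree is a vertex of degree at most $1$. Trees of stars are defined inductively: a single vertex is a tree of stars; if $T_1,\dots,T_k$ ($k\ge 2$) are disjoint trees of stars and $v_i$ is a leaf of $T_i$ for each $i$, then the tree obtained from $T_1\cup\dots\cup T_k$ by adding a new vertex $w$ adjacent to every $v_i$ is a tree of stars. In a tree of stars, for any fixed vertex $v$, the distances from $v$ to all leaves have the same parity; $v$ is a center if these distances are odd. A tree of stars is balanced if the degrees of any two of its centers differ by at most $1$. *)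

theory Defs
  imports Main
begin

type_synonym 'a sgraph = "'a set \<times> 'a set set"

abbreviation vertices :: "'a sgraph \<Rightarrow> 'a set" where
  "vertices G \<equiv> fst G"

abbreviation edges :: "'a sgraph \<Rightarrow> 'a set set" where
  "edges G \<equiv> snd G"

definition simple_graph :: "'a sgraph \<Rightarrow> bool" where
  "simple_graph G \<longleftrightarrow> finite (vertices G) \<and> (\<forall>e\<in>edges G. e \<subseteq> vertices G \<and> card e = 2)"

definition adjacent :: "'a sgraph \<Rightarrow> 'a \<Rightarrow> 'a \<Rightarrow> bool" where
  "adjacent G u v \<longleftrightarrow> {u, v} \<in> edges G"

definition vertex_degree :: "'a sgraph \<Rightarrow> 'a \<Rightarrow> nat" where
  "vertex_degree G v = card {e \<in> edges G. v \<in> e}"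

definition leaf :: "'a sgraph \<Rightarrow> 'a \<Rightarrow> bool" where
  "leaf G v \<longleftrightarrow> v \<in> vertices G \<and> vertex_degree G v \<le> 1"

definition walk :: "'a sgraph \<Rightarrow> 'a list \<Rightarrow> bool" where
  "walk G p \<longleftrightarrow> p \<noteq> [] \<and> set p \<subseteq> vertices G \<and> successively (adjacent G) p"

definition walk_between :: "'a sgraph \<Rightarrow> 'a \<Rightarrow> 'a list \<Rightarrow> 'a \<Rightarrow> bool" where
  "walk_between G u p v \<longleftrightarrow> walk G p \<and> hd p = u \<and> last p = v"

definition connected_graph :: "'a sgraph \<Rightarrow> bool" where
  "connected_graph G \<longleftrightarrow>
     vertices G \<noteq> {} \<and> (\<forall>u\<in>vertices G. \<forall>v\<in>vertices G. \<exists>p. walk_between G u p v)"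

definition graph_cycle :: "'a sgraph \<Rightarrow> 'a list \<Rightarrow> bool" where
  "graph_cycle G p \<longleftrightarrow> walk G p \<and> distinct p \<and> 3 \<le> length p \<and> adjacent G (last p) (hd p)"

definition is_tree :: "'a sgraph \<Rightarrow> bool" where
  "is_tree G \<longleftrightarrow> simple_graph G \<and> connected_graph G \<and> (\<nexists>p. graph_cycle G p)"

text \<open>Only meaningful when some walk joins \<open>u\<close> and \<open>v\<close>; used for trees only.\<close>

definition graph_dist :: "'a sgraph \<Rightarrow> 'a \<Rightarrow> 'a \<Rightarrow> nat" where
  "graph_dist G u v = (LEAST n. \<exists>p. walk_between G u p v \<and> length p = Suc n)"

definition stable_sets :: "'a sgraph \<Rightarrow> 'a set set" where
  "stable_sets G = {S. S \<subseteq> vertices G \<and> (\<forall>u\<in>S. \<forall>v\<in>S. \<not> adjacent G u v)}"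

definition num_stable_sets :: "'a sgraph \<Rightarrow> nat" where
  "num_stable_sets G = card (stable_sets G)"

definition stability_number :: "'a sgraph \<Rightarrow> nat" where
  "stability_number G = Max (card ` stable_sets G)"

text \<open>
  The competitors range over the trees whose vertices lie in the type \<open>'a\<close>. This is no
  restriction: they have as many vertices as \<open>T\<close>, so every isomorphism class of
  competitors has a representative on the vertex set of \<open>T\<close> itself.
\<close>

definition extremal_tree :: "'a sgraph \<Rightarrow> bool" where
  "extremal_tree T \<longleftrightarrow> is_tree T \<and>
     (\<forall>T' :: 'a sgraph. is_tree T' \<and> card (vertices T') = card (vertices T) \<and>
        stability_number T' = stability_number T \<longrightarrow> num_stable_sets T \<le> num_stable_sets T')"

inductive tree_of_stars :: "'a sgraph \<Rightarrow> bool" where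
  single: "tree_of_stars ({v}, {})"
| join: "tree_of_stars (insert w (\<Union>i<k. vertices (T i)),
           (\<Union>i<k. edges (T i)) \<union> (\<lambda>i. {w, v i}) ` {..<k})"
  if "2 \<le> (k :: nat)"
    and "\<forall>i<k. tree_of_stars (T i)"
    and "\<forall>i<k. \<forall>j<k. i \<noteq> j \<longrightarrow> vertices (T i) \<inter> vertices (T j) = {}"
    and "\<forall>i<k. leaf (T i) (v i)"
    and "w \<notin> (\<Union>i<k. vertices (T i))"

definition center :: "'a sgraph \<Rightarrow> 'a \<Rightarrow> bool" where
  "center T v \<longleftrightarrow> v \<in> vertices T \<and> (\<forall>l. leaf T l \<longrightarrow> odd (graph_dist T v l))"

text \<open>
  Since \<open>u\<close> and \<open>v\<close> are interchangeable, the inequality bounds the absolute difference of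
  the two degrees.
\<close>

definition balanced_tree_of_stars :: "'a sgraph \<Rightarrow> bool" where
  "balanced_tree_of_stars T \<longleftrightarrow> tree_of_stars T \<and>
     (\<forall>u v. center T u \<and> center T v \<longrightarrow> vertex_degree T u \<le> vertex_degree T v + 1)"

definition path_graph :: "'a sgraph \<Rightarrow> bool" where
  "path_graph G \<longleftrightarrow> (\<exists>p. p \<noteq> [] \<and> distinct p \<and> vertices G = set p \<and>
     edges G = {{p ! i, p ! Suc i} | i. Suc i < length p})"

end

theory Submission
  imports Defs Complex_Main
begin

text \<open>
  Deleting an edge of a tree and joining the two sides by another edge changes the number of stable
  sets only through the number of stable sets containing the end vertices, and preserves the
  stability number as long as the old and the new ends agree on whether both lie in all maximum
  stable sets of their sides (are \<^emph>\<open>essential\<close>). Hence the ends of an edge of an extremal tree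
  maximize the product of these numbers among all admissible pairs.

  At a vertex \<open>v\<close> of degree at least 3, the neighbour on every edge is essential in its branch:
  otherwise that branch could be hung on any other vertex, and comparing \<open>v\<close> with a suitable leaf of
  another branch, together with the condition for the edge from \<open>v\<close> to this branch, gives a
  contradiction. So some edge has exactly one essential end, unless all degrees are at most 2.
  This property spreads from an edge to all edges, and then the essential vertices of the tree form
  a class of the bipartition with degrees at most 2, whose complement has degrees at least 2: a tree
  of stars. If no edge has this property, the tree is a path, and its number of edges is odd.
  Finally, if the degrees of two centers differ by more than 1, a branch of the center of large degree
  can be moved to a center of minimum degree.
\<close>

section \<open>Stable sets\<close>

text \<open>With sides A and B and the edge from x to y between them, F(A \<union> B) = F(A) F(B) -
  F_x(A) F_y(B), where a subscript restricts to stable sets through that vertex. F(A) and F(B) do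
  not change in an exchange, so a larger product means fewer stable sets. The obstacle is the
  stability number. With y kept, x can be moved freely if y is not essential, but only within its
  own status if y is. Hence the comparisons are made with leaves and neighbours of leaves, whose
  status can be controlled. Degree at least 3 matters because the estimate at v uses two branches
  besides the moved one: the branch with the smaller ratio F(U) / F(U - u) supplies the leaf, the
  other one bounds the odds that a stable set contains v. For the balance, the odds of a center are
  a product of one factor F(B - u) / F(B) per branch. Each factor is at least 1/2, and an upper
  bound r is one that reproduces itself from the leaves upwards. The two bounds must be close enough
  to detect a degree difference of 2 for every minimum degree, and for small degrees there is little
  room.\<close>

text \<open>The edge set stays global and only the vertex set varies, so deleting a vertex or
  passing to a branch is plain set arithmetic. Since u = v is allowed, a loop would exclude its
  vertex; this is why \<open>{x} \<notin> E\<close> appears as a hypothesis below.\<close>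

definition stables :: "'a set set \<Rightarrow> 'a set \<Rightarrow> 'a set set" where
  "stables E W = {S. S \<subseteq> W \<and> (\<forall>u\<in>S. \<forall>v\<in>S. {u, v} \<notin> E)}"

definition count :: "'a set set \<Rightarrow> 'a set \<Rightarrow> real" where
  "count E W = real (card (stables E W))"

text \<open>The number of stable sets through \<open>x\<close>, by \<open>count_at_eq\<close>. The
  difference form, over the reals, turns all recurrences into algebra, and the value is 0 when
  \<open>x \<notin> W\<close>.\<close>

definition count_at :: "'a set set \<Rightarrow> 'a set \<Rightarrow> 'a \<Rightarrow> real" where
  "count_at E W x = count E W - count E (W - {x})"

definition indep :: "'a set set \<Rightarrow> 'a set \<Rightarrow> nat" where
  "indep E W = Max (card ` stables E W)"

text \<open>A drop of the stability number, rather than membership in all maximum stable sets, makes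
  the notion false for \<open>x \<notin> W\<close> and lets it enter the additivity formulas
  directly.\<close>

definition essential :: "'a set set \<Rightarrow> 'a set \<Rightarrow> 'a \<Rightarrow> bool" where
  "essential E W x \<longleftrightarrow> indep E (W - {x}) < indep E W"

lemma stables_subset: "S \<in> stables E W \<Longrightarrow> S \<subseteq> W"
  by (auto simp: stables_def)

lemma stables_mono: "S \<in> stables E W \<Longrightarrow> S' \<subseteq> S \<Longrightarrow> S' \<subseteq> W' \<Longrightarrow> S' \<in> stables E W'"
  unfolding stables_def by blast

lemma empty_in_stables [simp]: "{} \<in> stables E W"
  by (auto simp: stables_def)

lemma finite_stables: "finite W \<Longrightarrow> finite (stables E W)"
  by (rule finite_subset[of _ "Pow W"]) (auto simp: stables_def)

lemma stables_cong: "(\<And>u v. u \<in> W \<Longrightarrow> v \<in> W \<Longrightarrow> {u, v} \<in> E \<longleftrightarrow> {u, v} \<in> E') \<Longrightarrow> stables E W = stables E' W"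
  unfolding stables_def by (intro Collect_cong) blast

lemma count_empty [simp]: "count E {} = 1"
proof -
  have "stables E {} = {{}}"
    by (auto simp: stables_def)
  then show ?thesis
    by (simp add: count_def)
qed

lemma count_pos: "finite W \<Longrightarrow> 0 < count E W"
  unfolding count_def using finite_stables[of W E] empty_in_stables[of E W]
  by (metis card_gt_0_iff empty_iff of_nat_0_less_iff)

lemma count_at_eq:
  assumes "finite W"
  shows "count_at E W x = real (card {S \<in> stables E W. x \<in> S})"
proof -
  have "stables E W = stables E (W - {x}) \<union> {S \<in> stables E W. x \<in> S}"
    by (auto simp: stables_def)
  moreover have "stables E (W - {x}) \<inter> {S \<in> stables E W. x \<in> S} = {}"
    by (auto simp: stables_def)
  ultimately have "card (stables E W) = card (stables E (W - {x})) + card {S \<in> stables E W. x \<in> S}"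
    using card_Un_disjoint[of "stables E (W - {x})" "{S \<in> stables E W. x \<in> S}"] finite_stables[OF assms]
      finite_stables[of "W - {x}" E] assms by auto
  then show ?thesis
    by (simp add: count_at_def count_def)
qed

lemma count_at_nonneg: "finite W \<Longrightarrow> 0 \<le> count_at E W x"
  by (simp add: count_at_eq)

lemma count_at_pos:
  assumes "finite W" "x \<in> W" "{x} \<notin> E"
  shows "0 < count_at E W x"
proof -
  have "{x} \<in> {S \<in> stables E W. x \<in> S}"
    using assms by (auto simp: stables_def)
  moreover have "finite {S \<in> stables E W. x \<in> S}"
    using finite_stables[OF assms(1)] by auto
  ultimately have "0 < card {S \<in> stables E W. x \<in> S}"
    using card_gt_0_iff by blast
  then show ?thesis
    by (simp add: count_at_eq[OF assms(1)])
qed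

lemma count_Diff_less: "finite W \<Longrightarrow> x \<in> W \<Longrightarrow> {x} \<notin> E \<Longrightarrow> count E (W - {x}) < count E W"
  using count_at_pos[of W x E] by (simp add: count_at_def)

text \<open>Dropping \<open>x\<close> is injective on the stable sets through \<open>x\<close>, so
  the odds of a vertex never exceed 1. In the form \<open>count_le_twice\<close> this gives the
  factor 1/2 used in all later lower bounds.\<close>

lemma count_at_le:
  assumes "finite W"
  shows "count_at E W x \<le> count E (W - {x})"
proof -
  have inj: "inj_on (\<lambda>S. S - {x}) {S \<in> stables E W. x \<in> S}"
    by (rule inj_onI) auto
  moreover have "(\<lambda>S. S - {x}) ` {S \<in> stables E W. x \<in> S} \<subseteq> stables E (W - {x})"
    by (auto simp: stables_def)
  ultimately have "card {S \<in> stables E W. x \<in> S} \<le> card (stables E (W - {x}))"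
    using card_inj_on_le finite_stables[of "W - {x}" E] assms by blast
  then show ?thesis
    by (simp add: count_at_eq[OF assms] count_def)
qed

lemma count_le_twice: "finite W \<Longrightarrow> count E W \<le> 2 * count E (W - {x})"
  using count_at_le[of W E x] by (simp add: count_at_def)

text \<open>For distinct \<open>x\<close> and \<open>y\<close>, inclusion and exclusion makes the
  gap the number of stable sets containing both, and \<open>{x, y}\<close> is one of them.\<close>

lemma count_pair_pos:
  assumes "finite W" "x \<in> W" "y \<in> W" "{x} \<notin> E" "{y} \<notin> E" "{x, y} \<notin> E"
  shows "count E (W - {x}) + count E (W - {y}) < count E W + count E (W - {x} - {y})"
proof -
  have "{S \<in> stables E (W - {y}). x \<in> S} \<subset> {S \<in> stables E W. x \<in> S}"
  proof
    show "{S \<in> stables E (W - {y}). x \<in> S} \<subseteq> {S \<in> stables E W. x \<in> S}"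
      by (auto simp: stables_def)
    have "{x, y} \<in> {S \<in> stables E W. x \<in> S}"
      using assms by (auto simp: stables_def insert_commute)
    moreover have "{x, y} \<notin> {S \<in> stables E (W - {y}). x \<in> S}"
      by (auto simp: stables_def)
    ultimately show "{S \<in> stables E (W - {y}). x \<in> S} \<noteq> {S \<in> stables E W. x \<in> S}"
      by blast
  qed
  then have "card {S \<in> stables E (W - {y}). x \<in> S} < card {S \<in> stables E W. x \<in> S}"
    using finite_stables[OF assms(1)] by (intro psubset_card_mono) auto
  then have "count_at E (W - {y}) x < count_at E W x"
    using assms(1) by (simp add: count_at_eq)
  moreover have "W - {y} - {x} = W - {x} - {y}"
    by auto
  ultimately show ?thesis
    by (simp add: count_at_def)
qed

lemma stables_Un:
  assumes P: "P \<in> stables E A" and Q: "Q \<in> stables E B" and n: "\<not> (x \<in> P \<and> y \<in> Q)"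
    and cross: "\<And>a b. a \<in> A \<Longrightarrow> b \<in> B \<Longrightarrow> {a, b} \<in> E \<Longrightarrow> a = x \<and> b = y"
  shows "P \<union> Q \<in> stables E (A \<union> B)"
proof -
  have PQ: "{u, v} \<notin> E" if "u \<in> P" "v \<in> Q" for u v
    using cross[of u v] that n P Q by (auto simp: stables_def)
  have QP: "{v, u} \<notin> E" if "u \<in> P" "v \<in> Q" for u v
    using PQ[OF that] by (simp add: insert_commute)
  show ?thesis
    using P Q PQ QP unfolding stables_def by blast
qed

text \<open>The edge \<open>{x, y}\<close> may be absent from \<open>A \<union> B\<close> (when \<open>x \<notin> A\<close> or \<open>y \<notin> B\<close>); the
  correction term then vanishes, so the formula also covers the case of no crossing edge.\<close>

lemma count_Un:
  assumes fin: "finite A" "finite B" and "A \<inter> B = {}" and xy: "{x, y} \<in> E"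
    and cross: "\<And>a b. a \<in> A \<Longrightarrow> b \<in> B \<Longrightarrow> {a, b} \<in> E \<Longrightarrow> a = x \<and> b = y"
  shows "count E (A \<union> B) = count E A * count E B - count_at E A x * count_at E B y"
proof -
  let ?X = "{S \<in> stables E A. x \<in> S}" and ?Y = "{S \<in> stables E B. y \<in> S}"
  let ?P = "stables E A \<times> stables E B - ?X \<times> ?Y"
  have bij: "bij_betw (\<lambda>S. (S \<inter> A, S \<inter> B)) (stables E (A \<union> B)) ?P"
  proof (rule bij_betw_byWitness[where f' = "\<lambda>(P, Q). P \<union> Q"])
    show "\<forall>S\<in>stables E (A \<union> B). (case (S \<inter> A, S \<inter> B) of (P, Q) \<Rightarrow> P \<union> Q) = S"
      by (auto simp: stables_def)
    show "\<forall>PQ\<in>?P. ((case PQ of (P, Q) \<Rightarrow> P \<union> Q) \<inter> A, (case PQ of (P, Q) \<Rightarrow> P \<union> Q) \<inter> B) = PQ"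
      using assms(3) by (auto simp: stables_def)
    show "(\<lambda>S. (S \<inter> A, S \<inter> B)) ` stables E (A \<union> B) \<subseteq> ?P"
      using xy by (auto simp: stables_def)
    show "(\<lambda>(P, Q). P \<union> Q) ` ?P \<subseteq> stables E (A \<union> B)"
    proof
      fix S assume "S \<in> (\<lambda>(P, Q). P \<union> Q) ` ?P"
      then obtain P Q where S: "S = P \<union> Q" and P: "P \<in> stables E A" and Q: "Q \<in> stables E B"
        and n: "\<not> (x \<in> P \<and> y \<in> Q)"
        by auto
      show "S \<in> stables E (A \<union> B)"
        unfolding S using stables_Un[OF P Q n cross] .
    qed
  qed
  have "card (stables E (A \<union> B)) = card ?P"
    by (rule bij_betw_same_card[OF bij])
  also have "\<dots> = card (stables E A \<times> stables E B) - card (?X \<times> ?Y)"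
    using finite_stables[OF fin(1), of E] finite_stables[OF fin(2), of E]
    by (intro card_Diff_subset) auto
  finally have eq: "card (stables E (A \<union> B)) = card (stables E A \<times> stables E B) - card (?X \<times> ?Y)" .
  have "card (?X \<times> ?Y) \<le> card (stables E A \<times> stables E B)"
    using finite_stables[OF fin(1), of E] finite_stables[OF fin(2), of E]
    by (intro card_mono) auto
  with eq show ?thesis
    unfolding count_at_eq[OF fin(1)] count_at_eq[OF fin(2)] count_def
    by (simp add: card_cartesian_product)
qed

lemma count_singleton: "{x} \<notin> E \<Longrightarrow> count E {x} = 2"
proof -
  assume "{x} \<notin> E"
  then have "stables E {x} = {{}, {x}}"
    by (auto simp: stables_def)
  then show ?thesis
    by (simp add: count_def)
qed

text \<open>The case of \<open>count_Un\<close> in which one side is a single vertex. The neighbour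
  \<open>c\<close> may already be missing from \<open>W\<close>; then \<open>l\<close> is isolated
  and both summands coincide.\<close>

lemma count_leaf:
  assumes "finite W" "l \<in> W" "{l} \<notin> E" "{l, c} \<in> E" "\<And>w. w \<in> W \<Longrightarrow> {l, w} \<in> E \<Longrightarrow> w = c"
  shows "count E W = count E (W - {l}) + count E (W - {l} - {c})"
proof -
  have "count E {l} = 2"
    using count_singleton[OF assms(3)] .
  then have "count_at E {l} l = 1"
    by (simp add: count_at_def)
  moreover have "count E ({l} \<union> (W - {l}))
      = count E {l} * count E (W - {l}) - count_at E {l} l * count_at E (W - {l}) c"
    using assms by (intro count_Un) auto
  moreover have "{l} \<union> (W - {l}) = W"
    using assms(2) by auto
  ultimately show ?thesis
    using \<open>count E {l} = 2\<close> by (simp add: count_at_def)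
qed

section \<open>Maximum stable sets and essential vertices\<close>

lemma card_le_indep: "finite W \<Longrightarrow> S \<in> stables E W \<Longrightarrow> card S \<le> indep E W"
  unfolding indep_def using finite_stables[of W E] by (intro Max_ge) auto

lemma indep_witness:
  assumes "finite W"
  obtains S where "S \<in> stables E W" "card S = indep E W"
proof -
  have "indep E W \<in> card ` stables E W"
    unfolding indep_def
  proof (rule Max_in)
    show "finite (card ` stables E W)"
      using finite_stables[OF assms] by simp
    show "card ` stables E W \<noteq> {}"
      using empty_in_stables by blast
  qed
  then show ?thesis
    using that by auto
qed

lemma indep_mono:
  assumes "finite W" "W' \<subseteq> W"
  shows "indep E W' \<le> indep E W"
proof -
  obtain S where "S \<in> stables E W'" "card S = indep E W'"
    using indep_witness[of W' E] assms finite_subset by blast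
  then show ?thesis
    using card_le_indep[OF assms(1), of S E] assms(2) by (auto simp: stables_def)
qed

lemma essential_mem:
  assumes "finite W" "essential E W x" "S \<in> stables E W" "card S = indep E W"
  shows "x \<in> S"
proof (rule ccontr)
  assume "x \<notin> S"
  then have "S \<in> stables E (W - {x})"
    using assms(3) by (auto simp: stables_def)
  then show False
    using card_le_indep[of "W - {x}" S E] assms by (simp add: essential_def)
qed

lemma not_essential_witness:
  assumes "finite W" "\<not> essential E W x"
  obtains S where "S \<in> stables E W" "card S = indep E W" "x \<notin> S"
proof -
  obtain S where S: "S \<in> stables E (W - {x})" "card S = indep E (W - {x})"
    using indep_witness[of "W - {x}" E] assms(1) by blast
  have "S \<in> stables E W" "x \<notin> S"
    using S(1) by (auto simp: stables_def)
  moreover have "indep E (W - {x}) = indep E W"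
    using assms indep_mono[of W "W - {x}" E] by (auto simp: essential_def)
  ultimately show ?thesis
    using that S by metis
qed

lemma essential_indep:
  assumes "finite W" "essential E W x"
  shows "indep E W = Suc (indep E (W - {x}))"
proof -
  obtain S where S: "S \<in> stables E W" "card S = indep E W"
    using indep_witness[OF assms(1), of E] .
  have "S - {x} \<in> stables E (W - {x})"
    using S(1) by (auto simp: stables_def)
  then have "card (S - {x}) \<le> indep E (W - {x})"
    using card_le_indep assms(1) by blast
  moreover have "card S \<le> Suc (card (S - {x}))"
    by (simp add: card_Diff_singleton_if, linarith)
  ultimately show ?thesis
    using assms(2) S(2) by (auto simp: essential_def)
qed

lemma essential_singleton: "{x} \<notin> E \<Longrightarrow> essential E {x} x"
proof -
  assume "{x} \<notin> E"
  then have "{x} \<in> stables E {x}"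
    by (auto simp: stables_def)
  then have "1 \<le> indep E {x}"
    using card_le_indep[of "{x}" "{x}" E] by simp
  moreover have "indep E {} = 0"
    using indep_witness[of "{}" E] by (auto simp: stables_def)
  ultimately show ?thesis
    by (simp add: essential_def)
qed

text \<open>Maximum stable sets of the two sides can be united unless both are forced to contain the
  ends of the crossing edge, that is, unless both ends are essential. In that case giving up one end
  is enough.\<close>

lemma indep_Un:
  assumes fin: "finite A" "finite B" and dis: "A \<inter> B = {}" and xy: "{x, y} \<in> E"
    and cross: "\<And>a b. a \<in> A \<Longrightarrow> b \<in> B \<Longrightarrow> {a, b} \<in> E \<Longrightarrow> a = x \<and> b = y"
  shows "indep E (A \<union> B) + (if essential E A x \<and> essential E B y then 1 else 0) = indep E A + indep E B"
proof -
  have Un: "P \<union> Q \<in> stables E (A \<union> B) \<and> card (P \<union> Q) = card P + card Q"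
    if P: "P \<in> stables E A" and Q: "Q \<in> stables E B" and n: "\<not> (x \<in> P \<and> y \<in> Q)" for P Q
  proof
    show "P \<union> Q \<in> stables E (A \<union> B)"
      using stables_Un[OF P Q n cross] .
    show "card (P \<union> Q) = card P + card Q"
      using stables_subset[OF P] stables_subset[OF Q] fin dis
      by (intro card_Un_disjoint) (auto intro: finite_subset)
  qed
  obtain S where S: "S \<in> stables E (A \<union> B)" "card S = indep E (A \<union> B)"
    using indep_witness[of "A \<union> B" E] fin by blast
  have SA: "S \<inter> A \<in> stables E A" and SB: "S \<inter> B \<in> stables E B"
    using S(1) by (auto simp: stables_def)
  have "S = (S \<inter> A) \<union> (S \<inter> B)"
    using stables_subset[OF S(1)] by auto
  then have cS: "card S = card (S \<inter> A) + card (S \<inter> B)"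
    using fin dis card_Un_disjoint[of "S \<inter> A" "S \<inter> B"] by fastforce
  have le: "card (S \<inter> A) \<le> indep E A" "card (S \<inter> B) \<le> indep E B"
    using card_le_indep fin SA SB by blast+
  obtain P where P: "P \<in> stables E A" "card P = indep E A" "\<not> essential E A x \<longrightarrow> x \<notin> P"
    using indep_witness[OF fin(1), of E] not_essential_witness[OF fin(1), of E x] by metis
  obtain Q where Q: "Q \<in> stables E B" "card Q = indep E B" "\<not> essential E B y \<longrightarrow> y \<notin> Q"
    using indep_witness[OF fin(2), of E] not_essential_witness[OF fin(2), of E y] by metis
  show ?thesis
  proof (cases "essential E A x \<and> essential E B y")
    case True
    then have "\<not> (card (S \<inter> A) = indep E A \<and> card (S \<inter> B) = indep E B)"
      using essential_mem[OF fin(1) _ SA] essential_mem[OF fin(2) _ SB] xy S(1)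
      unfolding stables_def by blast
    with le cS S(2) have "indep E (A \<union> B) < indep E A + indep E B"
      by linarith
    moreover
    have "Q - {y} \<in> stables E B"
      using Q(1) by (auto simp: stables_def)
    then have "card P + card (Q - {y}) \<le> indep E (A \<union> B)"
      using Un[OF P(1)] card_le_indep[of "A \<union> B" _ E] fin by (metis Diff_iff finite_UnI insertI1)
    moreover have "card Q \<le> Suc (card (Q - {y}))"
      by (simp add: card_Diff_singleton_if, linarith)
    ultimately show ?thesis
      using True P Q by auto
  next
    case False
    then have "card (P \<union> Q) = card P + card Q" "card (P \<union> Q) \<le> indep E (A \<union> B)"
      using Un[OF P(1) Q(1)] card_le_indep[of "A \<union> B" _ E] fin P(3) Q(3) by auto
    with False le cS S(2) P Q show ?thesis
      by auto
  qed
qed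

text \<open>Deleting \<open>x\<close> also destroys the crossing edge. So if \<open>y\<close> is
  essential as well, the vertex lost with \<open>x\<close> is exactly the one that the crossing edge
  had already cost, and nothing drops.\<close>

lemma essential_Un:
  assumes fin: "finite A" "finite B" and dis: "A \<inter> B = {}" and xy: "{x, y} \<in> E" and x: "x \<in> A"
    and cross: "\<And>a b. a \<in> A \<Longrightarrow> b \<in> B \<Longrightarrow> {a, b} \<in> E \<Longrightarrow> a = x \<and> b = y"
  shows "essential E (A \<union> B) x \<longleftrightarrow> essential E A x \<and> \<not> essential E B y"
proof -
  have "A \<union> B - {x} = (A - {x}) \<union> B"
    using x dis by auto
  \<comment> \<open>Once \<open>x\<close> has left \<open>A\<close>, the correction term of
    \<open>indep_Un\<close> vanishes.\<close>
  moreover have "\<not> essential E (A - {x}) x"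
    by (simp add: essential_def)
  then have "indep E ((A - {x}) \<union> B) = indep E (A - {x}) + indep E B"
    using indep_Un[of "A - {x}" B x y E] assms by auto
  ultimately have "essential E (A \<union> B) x \<longleftrightarrow> indep E (A - {x}) + indep E B < indep E (A \<union> B)"
    by (simp add: essential_def)
  moreover have "indep E (A \<union> B) + (if essential E A x \<and> essential E B y then 1 else 0) = indep E A + indep E B"
    using indep_Un[OF fin dis xy cross] .
  moreover have "essential E A x \<Longrightarrow> indep E A = Suc (indep E (A - {x}))"
    using essential_indep[OF fin(1)] .
  moreover have "\<not> essential E A x \<Longrightarrow> indep E A = indep E (A - {x})"
    using indep_mono[OF fin(1), of "A - {x}" E] by (auto simp: essential_def)
  ultimately show ?thesis
    by (cases "essential E A x"; cases "essential E B y") simp_all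
qed

text \<open>Exchange: in a maximum stable set containing \<open>c\<close>, replacing
  \<open>c\<close> by the leaf \<open>l\<close> keeps the size and avoids \<open>c\<close>.\<close>

lemma leaf_neighbour_not_essential:
  assumes "finite W" "l \<in> W" "{l} \<notin> E" "{l, c} \<in> E" "\<And>w. w \<in> W \<Longrightarrow> {l, w} \<in> E \<Longrightarrow> w = c"
  shows "\<not> essential E W c"
proof
  assume c: "essential E W c"
  have "l \<noteq> c"
    using assms(3,4) by auto
  obtain S where S: "S \<in> stables E W" "card S = indep E W"
    using indep_witness[OF assms(1), of E] .
  have fin: "finite S"
    using finite_subset[OF stables_subset[OF S(1)] assms(1)] .
  have "c \<in> S"
    using essential_mem[OF assms(1) c S] .
  then have "l \<notin> S"
    using assms(4) S(1) by (auto simp: stables_def)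
  have no: "{l, w} \<notin> E" "{w, l} \<notin> E" if "w \<in> S - {c}" for w
    using that assms(5)[of w] stables_subset[OF S(1)] insert_commute[of w l "{}"] by auto
  have "S - {c} \<in> stables E (W - {c})"
    using S(1) stables_subset[OF S(1)] by (intro stables_mono[OF S(1)]) auto
  then have st: "insert l (S - {c}) \<in> stables E (W - {c})"
    using no assms(2,3) \<open>l \<noteq> c\<close> unfolding stables_def by auto
  have "card (insert l (S - {c})) = card S"
    using \<open>l \<notin> S\<close> card_Suc_Diff1[OF fin \<open>c \<in> S\<close>] fin by simp
  with card_le_indep[OF _ st] assms(1) c S(2) show False
    by (simp add: essential_def)
qed

section \<open>Trees and edge cuts\<close>

definition joined_at :: "'a set set \<Rightarrow> 'a set \<Rightarrow> 'a set \<Rightarrow> 'a \<Rightarrow> 'a \<Rightarrow> bool" where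
  "joined_at E A B x y \<longleftrightarrow> A \<inter> B = {} \<and> x \<in> A \<and> y \<in> B \<and> {x, y} \<in> E \<and>
     (\<forall>a\<in>A. \<forall>b\<in>B. {a, b} \<in> E \<longrightarrow> a = x \<and> b = y)"

text \<open>Trees are built by joining two trees along an edge rather than by adding leaves. Then
  any edge can serve as the last join (\<open>tree_on_cut\<close>), and inductions run over
  branches.\<close>

inductive tree_on :: "'a set set \<Rightarrow> 'a set \<Rightarrow> bool" for E where
  single: "{x} \<notin> E \<Longrightarrow> tree_on E {x}"
| join: "tree_on E A \<Longrightarrow> tree_on E B \<Longrightarrow> joined_at E A B x y \<Longrightarrow> tree_on E (A \<union> B)"

definition edge_cut :: "'a set set \<Rightarrow> 'a set \<Rightarrow> 'a set \<Rightarrow> 'a \<Rightarrow> 'a \<Rightarrow> bool" where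
  "edge_cut E A B x y \<longleftrightarrow> tree_on E A \<and> tree_on E B \<and> joined_at E A B x y"

lemma joined_atD:
  assumes "joined_at E A B x y"
  shows "A \<inter> B = {}" "x \<in> A" "y \<in> B" "{x, y} \<in> E"
    "\<And>a b. a \<in> A \<Longrightarrow> b \<in> B \<Longrightarrow> {a, b} \<in> E \<Longrightarrow> a = x \<and> b = y"
  using assms unfolding joined_at_def by blast+

lemma joined_at_sym: "joined_at E A B x y \<Longrightarrow> joined_at E B A y x"
  unfolding joined_at_def using insert_commute[of _ _ "{}"] by (metis Int_commute)

lemma tree_on_finite: "tree_on E W \<Longrightarrow> finite W"
  by (induction rule: tree_on.induct) simp_all

lemma tree_on_nonempty: "tree_on E W \<Longrightarrow> W \<noteq> {}"
  by (induction rule: tree_on.induct) simp_all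

lemma tree_on_loopfree: "tree_on E W \<Longrightarrow> x \<in> W \<Longrightarrow> {x} \<notin> E"
  by (induction rule: tree_on.induct) blast+

lemma edge_cut_tree: "edge_cut E A B x y \<Longrightarrow> tree_on E (A \<union> B)"
  unfolding edge_cut_def by (elim conjE) (rule tree_on.join)

lemma edge_cutD:
  assumes "edge_cut E A B x y"
  shows "tree_on E A" "tree_on E B" "finite A" "finite B" "A \<inter> B = {}" "x \<in> A" "y \<in> B" "{x, y} \<in> E"
    "x \<notin> B" "y \<notin> A" "x \<noteq> y" "{x} \<notin> E" "{y} \<notin> E"
proof -
  have c: "tree_on E A" "tree_on E B" "A \<inter> B = {}" "x \<in> A" "y \<in> B" "{x, y} \<in> E"
    using assms unfolding edge_cut_def joined_at_def by blast+
  then show "tree_on E A" "tree_on E B" "A \<inter> B = {}" "x \<in> A" "y \<in> B" "{x, y} \<in> E"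
    by blast+
  show "finite A" "finite B"
    using c(1,2) tree_on_finite by blast+
  show "x \<notin> B" "y \<notin> A" "x \<noteq> y"
    using c by blast+
  show "{x} \<notin> E" "{y} \<notin> E"
    using tree_on_loopfree[OF c(1,4)] tree_on_loopfree[OF c(2,5)] .
qed

lemma edge_cut_cross: "edge_cut E A B x y \<Longrightarrow> a \<in> A \<Longrightarrow> b \<in> B \<Longrightarrow> {a, b} \<in> E \<Longrightarrow> a = x \<and> b = y"
  unfolding edge_cut_def joined_at_def by blast

lemma edge_cut_sym: "edge_cut E A B x y \<Longrightarrow> edge_cut E B A y x"
  unfolding edge_cut_def by (simp add: joined_at_sym)

text \<open>A branch \<open>C\<close> hanging at a vertex of \<open>A\<close> simply travels with
  \<open>A\<close> when the edge from \<open>x\<close> to \<open>y\<close> is cut.\<close>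

lemma edge_cut_extend:
  assumes AB: "edge_cut E A B x y" and C: "edge_cut E (A \<union> B) C p q" and p: "p \<in> A"
  shows "edge_cut E (A \<union> C) B x y" "edge_cut E A C p q"
proof -
  show AC: "edge_cut E A C p q"
    using AB C p unfolding edge_cut_def joined_at_def by blast
  have "{c, b} \<notin> E" if "c \<in> C" "b \<in> B" for b c
    using edge_cut_cross[OF C, of b c] that p edge_cutD(5)[OF AB] by (auto simp: insert_commute)
  then have "\<forall>a\<in>A \<union> C. \<forall>b\<in>B. {a, b} \<in> E \<longrightarrow> a = x \<and> b = y"
    using edge_cut_cross[OF AB] by blast
  moreover have "(A \<union> C) \<inter> B = {}"
    using edge_cutD(5)[OF AB] edge_cutD(5)[OF C] by auto
  ultimately show "edge_cut E (A \<union> C) B x y"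
    using edge_cut_tree[OF AC] AB unfolding edge_cut_def joined_at_def by blast
qed

text \<open>Either the edge is the one that joined the two parts, or it lies inside one part and is
  cut there by induction. The other part then goes to the side that contains its attachment
  vertex.\<close>

lemma tree_on_cut:
  assumes "tree_on E W" "x \<in> W" "y \<in> W" "{x, y} \<in> E"
  obtains A B where "W = A \<union> B" "edge_cut E A B x y"
proof -
  have "\<exists>A B. W = A \<union> B \<and> edge_cut E A B x y"
    using assms
  proof (induction arbitrary: x y rule: tree_on.induct)
    case (single z)
    then show ?case
      by auto
  next
    case (join A B p q)
    have pq: "edge_cut E A B p q"
      using join.hyps unfolding edge_cut_def by blast
    have inner: "\<exists>A' B'. A \<union> B = A' \<union> B' \<and> edge_cut E A' B' x y"
      if "edge_cut E A B p q" "A = A1 \<union> A2" "edge_cut E A1 A2 x y" for A B A1 A2 p q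
    proof (cases "p \<in> A1")
      case True
      then have "edge_cut E (A1 \<union> B) A2 x y"
        using edge_cut_extend[OF that(3)] that by blast
      moreover have "A \<union> B = (A1 \<union> B) \<union> A2"
        using that by auto
      ultimately show ?thesis
        by blast
    next
      case False
      then have "p \<in> A2"
        using that edge_cutD(6) by fastforce
      then have "edge_cut E (A2 \<union> B) A1 y x"
        using edge_cut_extend[OF edge_cut_sym[OF that(3)]] that by (metis sup_commute)
      then have "edge_cut E A1 (A2 \<union> B) x y"
        by (rule edge_cut_sym)
      moreover have "A \<union> B = A1 \<union> (A2 \<union> B)"
        using that by auto
      ultimately show ?thesis
        by blast
    qed
    consider "x \<in> A" "y \<in> A" | "x \<in> B" "y \<in> B" | "x \<in> A" "y \<in> B" | "x \<in> B" "y \<in> A"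
      using join.prems by blast
    then show ?case
    proof cases
      case 1
      then show ?thesis
        using join.IH(1)[of x y] join.prems inner[OF pq] by blast
    next
      case 2
      then show ?thesis
        using join.IH(2)[of x y] join.prems inner[OF edge_cut_sym[OF pq]] by (metis sup_commute)
    next
      case 3
      then show ?thesis
        using pq edge_cut_cross[OF pq] join.prems by blast
    next
      case 4
      then show ?thesis
        using edge_cut_sym[OF pq] edge_cut_cross[OF edge_cut_sym[OF pq]] join.prems by blast
    qed
  qed
  then show ?thesis
    using that by blast
qed

lemma tree_on_cong:
  assumes "tree_on E W" "\<And>u v. u \<in> W \<Longrightarrow> v \<in> W \<Longrightarrow> {u, v} \<in> E \<longleftrightarrow> {u, v} \<in> E'"
  shows "tree_on E' W"
  using assms
proof (induction rule: tree_on.induct)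
  case (single x)
  from single(1) single(2)[of x x] show ?case
    by (intro tree_on.single) auto
next
  case (join A B x y)
  show ?case
  proof (rule tree_on.join)
    show "tree_on E' A" "tree_on E' B"
      using join.IH join.prems by blast+
    show "joined_at E' A B x y"
      using join.hyps join.prems unfolding joined_at_def by blast
  qed
qed

text \<open>Paths on the two sides meet at the joining edge. Distinctness is what later allows such
  a path to be closed up to a cycle.\<close>

lemma tree_on_path:
  assumes "tree_on E W" "x \<in> W" "y \<in> W"
  shows "\<exists>p. p \<noteq> [] \<and> distinct p \<and> set p \<subseteq> W \<and> successively (\<lambda>u v. {u, v} \<in> E) p \<and> hd p = x \<and> last p = y"
  using assms
proof (induction arbitrary: x y rule: tree_on.induct)
  case (single z)
  then show ?case
    by (intro exI[of _ "[z]"]) auto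
next
  case (join A B u v)
  note J = joined_atD[OF join.hyps(3)]
  have across: "\<exists>p. p \<noteq> [] \<and> distinct p \<and> set p \<subseteq> A \<union> B \<and> successively (\<lambda>u v. {u, v} \<in> E) p \<and> hd p = x \<and> last p = y"
    if p: "p \<noteq> []" "distinct p" "set p \<subseteq> A" "successively (\<lambda>u v. {u, v} \<in> E) p" "hd p = x" "last p = u"
     and q: "q \<noteq> []" "distinct q" "set q \<subseteq> B" "successively (\<lambda>u v. {u, v} \<in> E) q" "hd q = v" "last q = y"
     and uv: "A \<inter> B = {}" "{u, v} \<in> E" for p q and A B :: "'a set" and x y u v
    using that by (intro exI[of _ "p @ q"]) (auto simp: successively_append_iff)
  consider "x \<in> A" "y \<in> A" | "x \<in> B" "y \<in> B" | "x \<in> A" "y \<in> B" | "x \<in> B" "y \<in> A"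
    using join.prems by blast
  then show ?case
  proof cases
    case 1
    then show ?thesis
      using join.IH(1)[of x y] by (metis le_supI1)
  next
    case 2
    then show ?thesis
      using join.IH(2)[of x y] by (metis le_supI2)
  next
    case 3
    obtain p where p: "p \<noteq> []" "distinct p" "set p \<subseteq> A" "successively (\<lambda>u v. {u, v} \<in> E) p" "hd p = x" "last p = u"
      using join.IH(1)[of x u] 3 J by blast
    obtain q where q: "q \<noteq> []" "distinct q" "set q \<subseteq> B" "successively (\<lambda>u v. {u, v} \<in> E) q" "hd q = v" "last q = y"
      using join.IH(2)[of v y] 3 J by blast
    show ?thesis
      using across[OF p q J(1,4)] .
  next
    case 4
    obtain p where p: "p \<noteq> []" "distinct p" "set p \<subseteq> B" "successively (\<lambda>u v. {u, v} \<in> E) p" "hd p = x" "last p = v"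
      using join.IH(2)[of x v] 4 J by blast
    obtain q where q: "q \<noteq> []" "distinct q" "set q \<subseteq> A" "successively (\<lambda>u v. {u, v} \<in> E) q" "hd q = u" "last q = y"
      using join.IH(1)[of u y] 4 J by blast
    have BA: "B \<inter> A = {}" "{v, u} \<in> E"
      using J(1,4) by (auto simp: insert_commute)
    show ?thesis
      using across[OF p q BA] unfolding Un_commute[of B A] .
  qed
qed

lemma successively_one_side:
  assumes "successively (\<lambda>u v. {u, v} \<in> E) q" "set q \<subseteq> A \<union> B" "x \<notin> set q"
    "joined_at E A B x y"
  shows "set q \<subseteq> A \<or> set q \<subseteq> B"
  using assms
proof (induction q)
  case (Cons u q)
  show ?case
  proof (cases q)
    case Nil
    then show ?thesis
      using Cons.prems by auto
  next
    case (Cons v r)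
    have IH: "set q \<subseteq> A \<or> set q \<subseteq> B"
      using Cons.IH Cons.prems by (auto simp: successively_Cons)
    have uv: "{u, v} \<in> E" "{v, u} \<in> E" "u \<noteq> x" "v \<noteq> x" "v \<in> set q"
      using Cons.prems Cons by (auto simp: insert_commute)
    have "u \<in> A \<or> u \<in> B"
      using Cons.prems by auto
    then show ?thesis
      using IH uv joined_atD(5)[OF Cons.prems(4), of u v] joined_atD(5)[OF Cons.prems(4), of v u] by auto
  qed
qed auto

text \<open>A walk can change sides only through \<open>x\<close>. So a cycle avoiding
  \<open>x\<close> lies in one part, and a cycle through \<open>x\<close> minus \<open>x\<close> is
  a path in one part. If that part is \<open>B\<close>, both ends of the path are \<open>y\<close>,
  the only neighbour of \<open>x\<close> there.\<close>

lemma tree_on_acyclic: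
  assumes "tree_on E W" "distinct p" "set p \<subseteq> W" "3 \<le> length p" "successively (\<lambda>u v. {u, v} \<in> E) p"
    "{last p, hd p} \<in> E"
  shows False
  using assms
proof (induction arbitrary: p rule: tree_on.induct)
  case (single x)
  have "card (set p) \<le> card {x}"
    using single.prems by (intro card_mono) auto
  then show ?case
    using single.prems distinct_card[of p] by simp
next
  case (join A B x y)
  note J = joined_atD[OF join.hyps(3)]
  show ?case
  proof (cases "x \<in> set p")
    case False
    then show ?thesis
      using successively_one_side[of E p A B x y] join by blast
  next
    case True
    then obtain p1 p2 where p: "p = p1 @ x # p2"
      by (meson split_list)
    \<comment> \<open>The cycle is rotated so that removing \<open>x\<close> leaves a path whose two
      ends are neighbours of \<open>x\<close>.\<close>
    define q where "q = p2 @ p1"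
    have q: "successively (\<lambda>u v. {u, v} \<in> E) q" "x \<notin> set q" "distinct q" "set q \<subseteq> A \<union> B" "2 \<le> length q"
      using join.prems unfolding p q_def
      by (auto simp: successively_append_iff successively_Cons)
    have ends: "{x, hd q} \<in> E" "{x, last q} \<in> E"
      using join.prems q(5) unfolding p q_def
      by (cases p1; cases p2 rule: rev_cases; auto simp: successively_append_iff successively_Cons insert_commute hd_append split: if_splits)+
    have "q \<noteq> []"
      using q(5) by auto
    consider "set q \<subseteq> A" | "set q \<subseteq> B"
      using successively_one_side[OF q(1,4,2) join.hyps(3)] by blast
    then show ?thesis
    proof cases
      case 1
      then have "set p \<subseteq> A"
        using J(2) unfolding p q_def by auto
      then show ?thesis
        using join.IH(1) join.prems by blast
    next
      case 2
      then have "hd q = y" "last q = y"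
        using ends J(5)[OF J(2)] \<open>q \<noteq> []\<close> by (meson hd_in_set last_in_set subsetD)+
      then show ?thesis
        using q(3,5) \<open>q \<noteq> []\<close> by (cases q) (auto split: if_splits)
    qed
  qed
qed

section \<open>Agreement with connected acyclic graphs\<close>

lemma tree_on_imp_is_tree:
  assumes "tree_on E V" "\<forall>e\<in>E. e \<subseteq> V \<and> card e = 2"
  shows "is_tree (V, E)"
proof -
  have adj: "adjacent (V, E) = (\<lambda>u v. {u, v} \<in> E)"
    by (intro ext) (simp add: adjacent_def)
  have "connected_graph (V, E)"
    unfolding connected_graph_def walk_between_def walk_def adj fst_conv
  proof (intro conjI ballI)
    show "V \<noteq> {}"
      using tree_on_nonempty[OF assms(1)] .
    show "\<exists>p. (p \<noteq> [] \<and> set p \<subseteq> V \<and> successively (\<lambda>u v. {u, v} \<in> E) p) \<and> hd p = u \<and> last p = v"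
      if "u \<in> V" "v \<in> V" for u v
      using tree_on_path[OF assms(1) that] by blast
  qed
  moreover have "\<nexists>p. graph_cycle (V, E) p"
    using tree_on_acyclic[OF assms(1)] unfolding graph_cycle_def walk_def adj fst_conv by blast
  ultimately show ?thesis
    using assms tree_on_finite unfolding is_tree_def simple_graph_def by auto
qed

lemma walk_leaves_set:
  assumes "successively P p" "p \<noteq> []" "hd p \<in> W" "last p \<notin> W"
  shows "\<exists>u v. u \<in> W \<and> v \<notin> W \<and> v \<in> set p \<and> P u v"
  using assms
proof (induction p)
  case (Cons u p)
  then show ?case
    by (cases p) (auto simp: successively_Cons)
qed auto

text \<open>A maximal vertex set that can be built by joins must be everything: by connectivity some
  edge leaves it, and a second edge to the same outer vertex would close a cycle, so that vertex
  could be joined.\<close>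

lemma is_tree_imp_tree_on:
  assumes "is_tree (V, E)"
  shows "tree_on E V"
proof -
  have fin: "finite V" and edge: "\<And>e. e \<in> E \<Longrightarrow> e \<subseteq> V \<and> card e = 2"
    and con: "connected_graph (V, E)" and acyc: "\<nexists>p. graph_cycle (V, E) p"
    using assms unfolding is_tree_def simple_graph_def by auto
  have adj: "adjacent (V, E) = (\<lambda>u v. {u, v} \<in> E)"
    by (intro ext) (simp add: adjacent_def)
  have loop: "{z} \<notin> E" for z
    using edge[of "{z}"] by auto
  let ?P = "\<lambda>W. W \<subseteq> V \<and> tree_on E W"
  obtain x where x: "x \<in> V"
    using con by (auto simp: connected_graph_def)
  have "?P {x}"
    using x loop by (auto intro: tree_on.single)
  moreover have "finite {W. ?P W}"
    using fin by simp
  ultimately obtain W where W: "?P W" and max: "\<And>W'. ?P W' \<Longrightarrow> W \<subseteq> W' \<Longrightarrow> W' = W"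
    using finite_has_maximal[of "{W. ?P W}"] by (metis (mono_tags, lifting) empty_iff mem_Collect_eq)
  have "W = V"
  proof (rule ccontr)
    assume "W \<noteq> V"
    then obtain t where t: "t \<in> V" "t \<notin> W"
      using W by auto
    obtain s where s: "s \<in> W"
      using W tree_on_nonempty by blast
    have "s \<in> V"
      using s W by blast
    then obtain p where p: "walk_between (V, E) s p t"
      using con t(1) unfolding connected_graph_def fst_conv by meson
    then obtain w z where wz: "w \<in> W" "z \<notin> W" "z \<in> set p" "{w, z} \<in> E"
      using walk_leaves_set[of "adjacent (V, E)" p W] s t unfolding walk_between_def walk_def adj by blast
    have z: "z \<in> V"
      using edge[OF wz(4)] by auto
    show False
    proof (cases "\<forall>a\<in>W. {a, z} \<in> E \<longrightarrow> a = w")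
      case True
      then have "joined_at E W {z} w z"
        using wz(1,2,4) unfolding joined_at_def by blast
      then have "tree_on E (W \<union> {z})"
        using W tree_on.join[of E W "{z}"] tree_on.single[of z E] loop by blast
      then have "W \<union> {z} = W"
        using W z by (intro max) blast+
      then show False
        using wz(2) by blast
    next
      case False
      then obtain a where a: "a \<in> W" "{a, z} \<in> E" "a \<noteq> w"
        by auto
      obtain q where q: "q \<noteq> []" "distinct q" "set q \<subseteq> W" "successively (\<lambda>u v. {u, v} \<in> E) q" "hd q = w" "last q = a"
        using tree_on_path[of E W w a] W wz a by blast
      have "2 \<le> length q"
        using q a(3) by (cases q; cases "tl q") auto
      then have "graph_cycle (V, E) (z # q)"
        using q a(2) W z wz(2,4) unfolding graph_cycle_def walk_def adj
        by (auto simp: successively_Cons insert_commute[of z w] insert_commute[of a z])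
      then show False
        using acyc by blast
    qed
  qed
  then show ?thesis
    using W by simp
qed

text \<open>The condition concerns only the conjunction for the two ends, because this is all that
  \<open>indep_Un\<close> sees. It is weaker than asking each end to keep its status.\<close>

lemma extremal_move:
  assumes ext: "extremal_tree (V, E)" and V: "V = A \<union> B" and c: "edge_cut E A B x y" and x': "x' \<in> A" and y': "y' \<in> B"
    and ess: "(essential E A x' \<and> essential E B y') = (essential E A x \<and> essential E B y)"
  shows "count_at E A x' * count_at E B y' \<le> count_at E A x * count_at E B y"
proof -
  have tree: "is_tree (V, E)"
    using ext by (simp add: extremal_tree_def)
  then have edge: "\<And>e. e \<in> E \<Longrightarrow> e \<subseteq> V \<and> card e = 2"
    unfolding is_tree_def simple_graph_def by auto
  note D = edge_cutD[OF c]
  note fD = D(3,4,5)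
  \<comment> \<open>The new edge set agrees with the old one inside \<open>A\<close> and inside
    \<open>B\<close>, so all quantities of the two sides carry over.\<close>
  define E' where "E' = insert {x', y'} (E - {{x, y}})"
  have agreeA: "{u, v} \<in> E' \<longleftrightarrow> {u, v} \<in> E" if "u \<in> A" "v \<in> A" for u v
    using that D y' unfolding E'_def by (auto simp: doubleton_eq_iff)
  have agreeB: "{u, v} \<in> E' \<longleftrightarrow> {u, v} \<in> E" if "u \<in> B" "v \<in> B" for u v
    using that D x' unfolding E'_def by (auto simp: doubleton_eq_iff)
  have stA: "stables E' W = stables E W" if "W \<subseteq> A" for W
    using agreeA that by (intro stables_cong) blast
  have stB: "stables E' W = stables E W" if "W \<subseteq> B" for W
    using agreeB that by (intro stables_cong) blast
  have cross: "a = x' \<and> b = y'" if "a \<in> A" "b \<in> B" "{a, b} \<in> E'" for a b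
    using that edge_cut_cross[OF c, of a b] D(5) x' y' unfolding E'_def by (auto simp: doubleton_eq_iff)
  have c': "edge_cut E' A B x' y'"
    unfolding edge_cut_def joined_at_def
  proof (intro conjI ballI impI)
    show "tree_on E' A" "tree_on E' B"
      using tree_on_cong[OF D(1)] tree_on_cong[OF D(2)] agreeA agreeB by simp_all
    show "{x', y'} \<in> E'"
      by (simp add: E'_def)
  qed (fact D(5) x' y' | rule cross[THEN conjunct1] cross[THEN conjunct2]; assumption)+
  have "card {x', y'} = 2"
    using x' y' D(5) by (metis card_2_iff disjoint_iff)
  then have "is_tree (V, E')"
    using edge_cut_tree[OF c'] edge x' y' unfolding V E'_def by (intro tree_on_imp_is_tree) auto
  have eqs: "count E' A = count E A" "count E' B = count E B" "count_at E' A x' = count_at E A x'"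
    "count_at E' B y' = count_at E B y'" "indep E' A = indep E A" "indep E' B = indep E B"
    "essential E' A x' = essential E A x'" "essential E' B y' = essential E B y'"
    unfolding count_at_def essential_def count_def indep_def using stA stB by simp_all
  have "indep E' V = indep E V"
    using indep_Un[OF fD D(8) edge_cut_cross[OF c]] indep_Un[OF fD edge_cutD(8)[OF c'] cross] ess
    unfolding eqs V by (auto split: if_splits)
  then have "stability_number (V, E') = stability_number (V, E)"
    unfolding stability_number_def indep_def stable_sets_def stables_def adjacent_def by simp
  then have "num_stable_sets (V, E) \<le> num_stable_sets (V, E')"
    using ext \<open>is_tree (V, E')\<close> unfolding extremal_tree_def by auto
  then have "count E V \<le> count E' V"
    unfolding num_stable_sets_def count_def stable_sets_def stables_def adjacent_def by simp
  then show ?thesis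
    using count_Un[OF fD D(8) edge_cut_cross[OF c]] count_Un[OF fD edge_cutD(8)[OF c'] cross]
    unfolding eqs V by auto
qed

lemma extremal_move_left:
  assumes "extremal_tree (V, E)" "V = A \<union> B" "edge_cut E A B x y" "x' \<in> A"
    and "essential E B y \<Longrightarrow> essential E A x' = essential E A x"
  shows "count_at E A x' \<le> count_at E A x"
proof -
  have "count_at E A x' * count_at E B y \<le> count_at E A x * count_at E B y"
    using assms edge_cutD[OF assms(3)] by (intro extremal_move[of V]) auto
  moreover have "0 < count_at E B y"
    using edge_cutD[OF assms(3)] by (intro count_at_pos)
  ultimately show ?thesis
    by simp
qed

section \<open>Vertices of degree at least three\<close>

lemma tree_on_neighbour:
  assumes "tree_on E W" "x \<in> W" "W \<noteq> {x}"
  shows "\<exists>y\<in>W. {x, y} \<in> E"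
  using assms
proof (induction rule: tree_on.induct)
  case (join A B p q)
  note J = joined_atD[OF join.hyps(3)]
  have "{q, p} \<in> E"
    using J(4) by (simp add: insert_commute)
  consider "x \<in> A" "A = {x}" | "x \<in> A" "A \<noteq> {x}" | "x \<in> B" "B = {x}" | "x \<in> B" "B \<noteq> {x}"
    using join.prems by blast
  then show ?case
    using join.IH J(2,3,4) \<open>{q, p} \<in> E\<close> by cases blast+
qed simp

lemma tree_on_peel:
  assumes "tree_on E W" "x \<in> W" "W \<noteq> {x}"
  obtains A B y where "W = A \<union> B" "edge_cut E A B x y"
  using tree_on_neighbour[OF assms] tree_on_cut[OF assms(1,2)] by metis

text \<open>Two branches at the same vertex can be cut off in either order.\<close>

lemma edge_cut_swap:
  assumes "edge_cut E (A \<union> B) C x z" "edge_cut E A B x y"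
  shows "edge_cut E (A \<union> C) B x y" "edge_cut E A C x z"
  using edge_cut_extend[OF assms(2,1) edge_cutD(6)[OF assms(2)]] .

lemma edge_cut_card:
  assumes "edge_cut E A B x y"
  shows "card A < card (A \<union> B)" "card B < card (A \<union> B)"
proof -
  note D = edge_cutD[OF assms]
  show "card A < card (A \<union> B)"
    using D by (intro psubset_card_mono) auto
  show "card B < card (A \<union> B)"
    using D by (intro psubset_card_mono) auto
qed

lemma count_Un_cut:
  assumes c: "edge_cut E A B x y" and "A' \<subseteq> A" "B' \<subseteq> B"
  shows "count E (A' \<union> B') = count E A' * count E B' - count_at E A' x * count_at E B' y"
proof (rule count_Un)
  show "finite A'" "finite B'" "A' \<inter> B' = {}" "{x, y} \<in> E"
    using assms(2,3) edge_cutD(3,4,5,8)[OF c] by (blast intro: finite_subset)+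
  show "a = x \<and> b = y" if "a \<in> A'" "b \<in> B'" "{a, b} \<in> E" for a b
    using edge_cut_cross[OF c, of a b] assms(2,3) that by blast
qed

lemma indep_Un_cut:
  assumes c: "edge_cut E A B x y" and "A' \<subseteq> A" "B' \<subseteq> B"
  shows "indep E (A' \<union> B') + (if essential E A' x \<and> essential E B' y then 1 else 0) = indep E A' + indep E B'"
proof (rule indep_Un)
  show "finite A'" "finite B'" "A' \<inter> B' = {}" "{x, y} \<in> E"
    using assms(2,3) edge_cutD(3,4,5,8)[OF c] by (blast intro: finite_subset)+
  show "a = x \<and> b = y" if "a \<in> A'" "b \<in> B'" "{a, b} \<in> E" for a b
    using edge_cut_cross[OF c, of a b] assms(2,3) that by blast
qed

lemma essential_cut:
  assumes "edge_cut E A B x y"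
  shows "essential E (A \<union> B) x \<longleftrightarrow> essential E A x \<and> \<not> essential E B y"
  using essential_Un[OF edge_cutD(3,4,5,8,6)[OF assms] edge_cut_cross[OF assms]] .

text \<open>A non-essential attachment vertex makes the stability number additive, before as well as
  after deleting \<open>l\<close>, so the drop in \<open>B\<close> is visible in the union.\<close>

lemma essential_cut_far:
  assumes c: "edge_cut E A B x y" and A: "\<not> essential E A x" and l: "l \<in> B" "essential E B l"
  shows "essential E (A \<union> B) l"
proof -
  note D = edge_cutD[OF c]
  have "indep E (A \<union> (B - {l})) = indep E A + indep E (B - {l})"
    using indep_Un_cut[OF c order_refl, of "B - {l}"] A by auto
  moreover have "A \<union> B - {l} = A \<union> (B - {l})"
    using D(5) l by auto
  moreover have "indep E (A \<union> B) = indep E A + indep E B"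
    using indep_Un_cut[OF c order_refl order_refl] A by simp
  ultimately show ?thesis
    using l by (simp add: essential_def)
qed

lemma count_Diff_cut:
  assumes "edge_cut E A B x y"
  shows "count E (A \<union> B - {x}) = count E (A - {x}) * count E B"
proof -
  note D = edge_cutD[OF assms]
  have "count_at E (A - {x}) x = 0"
    by (simp add: count_at_def)
  then have "count E ((A - {x}) \<union> B) = count E (A - {x}) * count E B"
    using count_Un_cut[OF assms _ order_refl, of "A - {x}"] by auto
  moreover have "A \<union> B - {x} = (A - {x}) \<union> B"
    using D by auto
  ultimately show ?thesis
    by simp
qed

text \<open>A stable set through \<open>x\<close> avoids \<open>y\<close>; otherwise its parts on
  the two sides are independent of each other.\<close>

lemma count_at_cut:
  assumes "edge_cut E A B x y"
  shows "count_at E (A \<union> B) x = count_at E A x * count E (B - {y})"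
  using count_Un_cut[OF assms order_refl order_refl] count_Diff_cut[OF assms]
  by (simp add: count_at_def algebra_simps)

text \<open>By \<open>essential_cut\<close>, a branch with non-essential root can be stripped
  without changing the status of \<open>x\<close>. If only such branches existed, \<open>x\<close>
  would finally stand alone and be essential.\<close>

lemma not_essential_branch:
  assumes "tree_on E W" "x \<in> W" "\<not> essential E W x"
  obtains A B y where "W = A \<union> B" "edge_cut E A B x y" "essential E B y"
proof -
  have "\<exists>A B y. W = A \<union> B \<and> edge_cut E A B x y \<and> essential E B y"
    using assms
  proof (induction "card W" arbitrary: W rule: less_induct)
    case less
    have "W \<noteq> {x}"
      using less.prems(3) essential_singleton[OF tree_on_loopfree[OF less.prems(1,2)]] by auto
    then obtain A B y where W: "W = A \<union> B" and c: "edge_cut E A B x y"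
      using tree_on_peel less.prems by metis
    show ?case
    proof (cases "essential E B y")
      case True
      then show ?thesis
        using W c by blast
    next
      case False
      then have "\<not> essential E A x"
        using less.prems(3) essential_cut[OF c] W by blast
      then obtain A' B' y' where A: "A = A' \<union> B'" and c': "edge_cut E A' B' x y'" "essential E B' y'"
        using less.hyps[of A] edge_cut_card[OF c] edge_cutD[OF c] W by blast
      have "edge_cut E (A' \<union> B) B' x y'"
        using edge_cut_swap(1)[of E A' B' B x y y'] c c' A by simp
      moreover have "W = (A' \<union> B) \<union> B'"
        using W A by auto
      ultimately show ?thesis
        using c' by blast
    qed
  qed
  then show ?thesis
    using that by blast
qed

section \<open>Leaves with prescribed status\<close>

definition pendant :: "'a set set \<Rightarrow> 'a set \<Rightarrow> 'a \<Rightarrow> 'a \<Rightarrow> bool" where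
  "pendant E W l c \<longleftrightarrow> l \<in> W \<and> c \<in> W \<and> {l, c} \<in> E \<and> (\<forall>w\<in>W. {l, w} \<in> E \<longrightarrow> w = c)"

lemma pendant_single_branch:
  assumes "edge_cut E A {y} x y"
  shows "pendant E (A \<union> {y}) y x"
proof -
  note D = edge_cutD[OF assms]
  have "w = x" if w: "w \<in> A \<union> {y}" and e: "{y, w} \<in> E" for w
  proof -
    have "w \<in> A"
      using w e D(13) by auto
    moreover have "{w, y} \<in> E"
      using e by (simp add: insert_commute)
    ultimately show ?thesis
      using edge_cut_cross[OF assms _ D(7)] by blast
  qed
  moreover have "{y, x} \<in> E"
    using D(8) by (simp add: insert_commute)
  ultimately show ?thesis
    using D(6) unfolding pendant_def by blast
qed

lemma pendant_cut:
  assumes c: "edge_cut E A B x y" and p: "pendant E B l z" "l \<noteq> y"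
  shows "pendant E (A \<union> B) l z"
proof -
  have "{l, a} \<notin> E" if "a \<in> A" for a
    using edge_cut_cross[OF c that, of l] p insert_commute[of l a "{}"] unfolding pendant_def by auto
  then show ?thesis
    using p unfolding pendant_def by auto
qed

lemma pendant_exists:
  assumes "tree_on E W" "x \<in> W" "W \<noteq> {x}"
  obtains l c where "pendant E W l c" "l \<noteq> x"
proof -
  have "\<exists>l c. pendant E W l c \<and> l \<noteq> x"
    using assms
  proof (induction "card W" arbitrary: W x rule: less_induct)
    case less
    obtain A B y where W: "W = A \<union> B" and c: "edge_cut E A B x y"
      using tree_on_peel less.prems by metis
    show ?case
    proof (cases "B = {y}")
      case True
      then show ?thesis
        using pendant_single_branch[of E A y x] c W edge_cutD(11)[OF c] by metis
    next
      case False
      then obtain l z where l: "pendant E B l z" "l \<noteq> y"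
        using less.hyps[of B y] edge_cut_card[OF c] edge_cutD[OF c] W by blast
      have "l \<noteq> x"
        using l edge_cutD[OF c] by (auto simp: pendant_def)
      then show ?thesis
        using pendant_cut[OF c l] W by blast
    qed
  qed
  then show ?thesis
    using that by blast
qed

lemma pendant_not_essential:
  assumes "tree_on E W" "pendant E W l c"
  shows "\<not> essential E W c"
  using leaf_neighbour_not_essential[of W l E c] assms tree_on_finite tree_on_loopfree
  unfolding pendant_def by metis

text \<open>The leaf is sought in a branch whose root \<open>y\<close> is essential. Neighbours of
  leaves are not essential, so the neighbour found there differs from \<open>y\<close>, which is the
  only neighbour of \<open>x\<close> in the branch. If the branch is \<open>y\<close> alone, the
  neighbour is \<open>x\<close>.\<close>

lemma pendant_nonadjacent:
  assumes "tree_on E W" "x \<in> W" "\<not> essential E W x"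
  obtains l c where "pendant E W l c" "l \<noteq> x" "c = x \<or> {x, c} \<notin> E"
proof -
  obtain A B y where W: "W = A \<union> B" and c: "edge_cut E A B x y" and y: "essential E B y"
    using not_essential_branch[OF assms] .
  note D = edge_cutD[OF c]
  show ?thesis
  proof (cases "B = {y}")
    case True
    then show ?thesis
      using that[of y x] pendant_single_branch[of E A y x] c W D by metis
  next
    case False
    then obtain l z where l: "pendant E B l z" "l \<noteq> y"
      using pendant_exists[OF D(2,7)] by metis
    have "z \<noteq> y"
      using pendant_not_essential[OF D(2) l(1)] y by auto
    moreover have "l \<in> B" "z \<in> B"
      using l by (auto simp: pendant_def)
    ultimately have "{x, z} \<notin> E" "l \<noteq> x"
      using edge_cut_cross[OF c D(6)] D by blast+
    then show ?thesis
      using that[of l z] pendant_cut[OF c l] W by blast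
  qed
qed

text \<open>The descent goes two levels at a time: a child \<open>b\<close> of \<open>x\<close> is
  not essential in its branch, so below it hangs a branch with essential root \<open>y\<close>, and
  the search restarts there.\<close>

lemma pendant_essential:
  assumes "tree_on E W" "x \<in> W" "W \<noteq> {x}" "essential E W x"
  obtains l c where "pendant E W l c" "l \<noteq> x" "essential E W l"
proof -
  have "\<exists>l c. pendant E W l c \<and> l \<noteq> x \<and> essential E W l"
    using assms
  proof (induction "card W" arbitrary: W x rule: less_induct)
    case less
    obtain A B b where W: "W = A \<union> B" and c: "edge_cut E A B x b"
      using tree_on_peel less.prems by metis
    have ess: "essential E A x" "\<not> essential E B b"
      using less.prems(4) essential_cut[OF c] W by blast+
    note D = edge_cutD[OF c]
    obtain B1 B2 y where B: "B = B1 \<union> B2" and c2: "edge_cut E B1 B2 b y" and y: "essential E B2 y"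
      using not_essential_branch[OF D(2,7) ess(2)] .
    note D2 = edge_cutD[OF c2]
    \<comment> \<open>Seen from \<open>b\<close>, the part \<open>A\<close> is just another branch.
      Its essential root \<open>x\<close> makes \<open>b\<close> non-essential outside
      \<open>B2\<close>, so essential vertices of \<open>B2\<close> remain essential in
      \<open>W\<close>.\<close>
    have c3: "edge_cut E (B1 \<union> A) B2 b y" "edge_cut E B1 A b x"
      using edge_cut_swap[of E B1 B2 A b x y] edge_cut_sym[OF c] c2 B by simp_all
    have b: "\<not> essential E (B1 \<union> A) b"
      using essential_cut[OF c3(2)] ess by blast
    have W2: "W = (B1 \<union> A) \<union> B2"
      using W B by auto
    have "x \<notin> B2"
      using D B by auto
    show ?case
    proof (cases "B2 = {y}")
      case True
      have "pendant E W y b"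
        using pendant_single_branch[of E "B1 \<union> A" y b] c3(1) True W2 by simp
      moreover have "essential E W y"
        using essential_cut_far[OF c3(1) b D2(7) y] W2 by simp
      ultimately show ?thesis
        using \<open>x \<notin> B2\<close> D2(7) by blast
    next
      case False
      have "card B2 < card W"
        using edge_cut_card(2)[OF c3(1)] W2 by simp
      then obtain l z where l: "pendant E B2 l z" "l \<noteq> y" "essential E B2 l"
        using less.hyps[of B2 y] False D2(2,7) y by blast
      have "l \<in> B2"
        using l(1) by (simp add: pendant_def)
      then show ?thesis
        using pendant_cut[OF c3(1) l(1,2)] essential_cut_far[OF c3(1) b _ l(3)] W2 \<open>x \<notin> B2\<close> by blast
    qed
  qed
  then show ?thesis
    using that by blast
qed

text \<open>The two linear hypotheses add up to 2 B < A + C. The letters stand for the counts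
  \<open>a\<close>, \<open>b\<close>, \<open>d\<close>, \<open>e\<close> of
  \<open>extremal_three_branches\<close>, here and in \<open>leaf_arith2\<close>.\<close>

lemma leaf_arith1:
  fixes A B C D :: real
  assumes "C * (A + C) \<le> B * (B + D)" "B + D \<le> 2 * C" "B + C < A + D" "0 < B" "0 < C"
  shows False
proof -
  have "B * (B + D) \<le> B * (2 * C)"
    using assms by (intro mult_left_mono) auto
  also have "\<dots> = C * (2 * B)"
    by simp
  also have "\<dots> < C * (A + C)"
    using assms by (intro mult_strict_left_mono) auto
  finally show False
    using assms(1) by simp
qed

lemma leaf_arith2:
  fixes A B C D :: real
  assumes "C * (A + C) \<le> B * (B + D)" "B + D \<le> A" "B \<le> 2 * D" "A \<le> 2 * C" "0 < A" "0 < B"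
  shows False
proof -
  \<comment> \<open>The hypotheses give C \<ge> A/2 and B \<le> 2A/3, so the left side is at least
    3/4 and the right side at most 2/3 of the square of A.\<close>
  have "(A / 2) * (3 * A / 2) \<le> C * (A + C)"
    using assms by (intro mult_mono) auto
  also have "\<dots> \<le> B * (B + D)"
    by fact
  also have "\<dots> \<le> (2 * A / 3) * A"
    using assms by (intro mult_mono) auto
  finally have "A * A / 12 \<le> 0"
    by (simp add: field_simps)
  moreover have "0 < A * A"
    using assms by simp
  ultimately show False
    by simp
qed

text \<open>With \<open>c\<close> the neighbour of the leaf \<open>l\<close> in the branch \<open>U\<^sub>1\<close>, put \<open>G = U\<^sub>1 - l\<close>. Moving the branch at
  \<open>u\<^sub>3\<close> from \<open>v\<close> to \<open>l\<close> yields one inequality between the numbers of stable sets of \<open>G\<close>, \<open>G - u\<^sub>1\<close>,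
  \<open>G - c\<close> and \<open>G - u\<^sub>1 - c\<close>; moving the edge \<open>{v, u\<^sub>1}\<close> to \<open>{v, c}\<close> or to \<open>{v, l}\<close> yields another,
  incompatible one.\<close>

lemma extremal_three_branches:
  assumes ext: "extremal_tree (V, E)" and V: "V = N \<union> U2 \<union> U1 \<union> U3"
    and c2: "edge_cut E N U2 v u2" and c1: "edge_cut E (N \<union> U2) U1 v u1" and c3: "edge_cut E (N \<union> U2 \<union> U1) U3 v u3"
    and u3: "\<not> essential E U3 u3"
    and le: "count E U1 * count E (U2 - {u2}) \<le> count E U2 * count E (U1 - {u1})"
  shows False
proof -
  define P where "P = N \<union> U2"
  define R where "R = P \<union> U1"
  note c1 = c1[folded P_def] and c3 = c3[folded P_def, folded R_def]
  note D1 = edge_cutD[OF c1] and D2 = edge_cutD[OF c2] and D3 = edge_cutD[OF c3]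
  have finP: "finite P" and finR: "finite R"
    using D1 D3 by auto
  define p q where "p = count_at E P v" and "q = count E (P - {v})"
  \<comment> \<open>No condition on \<open>z\<close>: as \<open>u3\<close> is not essential, its
    branch may hang anywhere on \<open>R\<close>.\<close>
  have M1: "count_at E R z \<le> count_at E R v" if "z \<in> R" for z
    using extremal_move_left[OF ext _ c3 that] V u3 by (auto simp: R_def P_def)
  have Rv: "count_at E R v = p * count E (U1 - {u1})"
    unfolding R_def p_def using count_at_cut[OF c1] .
  have q: "0 < q"
    using count_pos[of "P - {v}" E] finP by (simp add: q_def)
  have U2: "0 < count E (U2 - {u2})" "count E (U2 - {u2}) < count E U2"
    using count_pos[of "U2 - {u2}" E] count_Diff_less[of U2 u2 E] D2 by simp_all
  \<comment> \<open>Every branch at \<open>v\<close> multiplies the odds p / q by a factor at most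
    1. The factor of \<open>U2\<close> is kept, and the rest \<open>N\<close> is bounded by
    1.\<close>
  have pq: "p * count E U2 \<le> q * count E (U2 - {u2})"
  proof -
    have "count_at E N v * (count E (U2 - {u2}) * count E U2)
        \<le> count E (N - {v}) * (count E (U2 - {u2}) * count E U2)"
      using count_at_le[OF D2(3)] U2 by (intro mult_right_mono) auto
    then show ?thesis
      unfolding p_def q_def P_def count_at_cut[OF c2] count_Diff_cut[OF c2] by (simp add: mult_ac)
  qed
  show False
  proof (cases "U1 = {u1}")
    \<comment> \<open>Here the leaf is \<open>u1\<close> itself. Hanging the third branch on it
      gives q \<le> p, whereas \<open>pq\<close> forces p < q.\<close>
    case True
    have "count_at E (U1 \<union> P) u1 = count_at E U1 u1 * q"
      unfolding q_def using count_at_cut[OF edge_cut_sym[OF c1]] .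
    moreover have "1 \<le> count_at E U1 u1"
      using count_at_pos[of U1 u1 E] D1 by (simp add: count_at_eq)
    moreover have "count_at E R v = p"
      using Rv True by simp
    moreover have "q \<le> count_at E U1 u1 * q"
      using \<open>1 \<le> count_at E U1 u1\<close> q by simp
    ultimately have "q \<le> p"
      using M1[of u1] D1(7) by (simp add: R_def Un_commute)
    then have "q * count E U2 \<le> p * count E U2"
      using U2 by (intro mult_right_mono) auto
    also note pq
    also have "q * count E (U2 - {u2}) < q * count E U2"
      using q U2 by simp
    finally show False
      by simp
  next
    case False
    \<comment> \<open>The second exchange, within \<open>U1\<close>, must preserve the status of
      \<open>u1\<close>. So \<open>c\<close>, never essential, replaces a non-essential
      \<open>u1\<close>, and an essential leaf replaces an essential \<open>u1\<close>.\<close>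
    obtain l c where l: "pendant E U1 l c" "l \<noteq> u1"
      and lc: "\<not> essential E U1 u1 \<and> (c = u1 \<or> {u1, c} \<notin> E) \<or> essential E U1 u1 \<and> essential E U1 l"
      using pendant_nonadjacent[OF D1(2,7)] pendant_essential[OF D1(2,7) False] by metis
    have l': "l \<in> U1" "c \<in> U1" "{l, c} \<in> E"
      using l(1) unfolding pendant_def by blast+
    have loop: "{l} \<notin> E" "{c} \<notin> E" "l \<noteq> c"
      using tree_on_loopfree[OF D1(2)] l' by auto
    have leaf: "count E W = count E (W - {l}) + count E (W - {l} - {c})" if "W \<subseteq> U1" "l \<in> W" for W
    proof (rule count_leaf)
      show "finite W"
        using that D1(4) finite_subset by blast
      show "w = c" if "w \<in> W" "{l, w} \<in> E" for w
        using that \<open>W \<subseteq> U1\<close> l(1) unfolding pendant_def by blast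
    qed (use that l' loop in simp_all)
    define G where "G = U1 - {l}"
    define a b d e where "a = count E G" and "b = count E (G - {u1})" and "d = count E (G - {c})"
      and "e = count E (G - {u1} - {c})"
    have finG: "finite G"
      using D1(4) by (simp add: G_def)
    have inG: "u1 \<in> G" "c \<in> G"
      using D1(7) l' l(2) loop by (auto simp: G_def)
    have pos: "0 < a" "0 < b" "0 < d"
      using count_pos[of G E] count_pos[of "G - {u1}" E] count_pos[of "G - {c}" E] finG
      by (simp_all add: a_def b_def d_def)
    have U1: "count E U1 = a + d"
      unfolding a_def d_def G_def using leaf[of U1] l' by simp
    have U1u: "count E (U1 - {u1}) = b + e"
    proof -
      have "count E (U1 - {u1}) = count E (U1 - {u1} - {l}) + count E (U1 - {u1} - {l} - {c})"
        using l' l(2) by (intro leaf) auto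
      moreover have "U1 - {u1} - {l} = G - {u1}"
        by (auto simp: G_def)
      ultimately show ?thesis
        by (simp add: b_def e_def)
    qed
    have U1c: "count E (U1 - {c}) = 2 * d"
    proof -
      have "count E (U1 - {c}) = count E (U1 - {c} - {l}) + count E (U1 - {c} - {l} - {c})"
        using l' loop by (intro leaf) auto
      moreover have "U1 - {c} - {l} = G - {c}" "U1 - {c} - {l} - {c} = G - {c}"
        by (auto simp: G_def)
      ultimately show ?thesis
        by (simp add: d_def)
    qed
    \<comment> \<open>A stable set through \<open>l\<close> avoids \<open>c\<close>. What remains in
      \<open>U1\<close> is counted by \<open>d\<close> if \<open>v\<close> is absent, and by
      \<open>e\<close> if \<open>v\<close> is present and excludes \<open>u1\<close>.\<close>
    have Rl: "count_at E R l = q * d + p * e"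
    proof -
      have P: "count E P = p + q"
        by (simp add: p_def q_def count_at_def)
      have "count E R = count E P * count E U1 - p * count_at E U1 u1"
        unfolding R_def p_def using count_Un_cut[OF c1 order_refl order_refl] .
      moreover have "count E (P \<union> G) = count E P * count E G - p * count_at E G u1"
        unfolding p_def using count_Un_cut[OF c1 order_refl, of G] by (simp add: G_def)
      moreover have "R - {l} = P \<union> G"
        using D1(5) l' by (auto simp: R_def G_def)
      moreover have "count_at E U1 u1 = a + d - (b + e)" "count_at E G u1 = a - b"
        using U1 U1u by (simp_all add: count_at_def a_def b_def)
      ultimately show ?thesis
        unfolding count_at_def[of E R] P U1 by (simp add: a_def[symmetric] algebra_simps)
    qed
    \<comment> \<open>The summand \<open>p * e\<close> cancels in \<open>M1\<close> for
      \<open>l\<close>. Next \<open>pq\<close> eliminates \<open>p\<close> and \<open>q\<close>, and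
      \<open>le\<close> eliminates \<open>U2\<close>, so that \<open>main\<close> speaks of
      \<open>U1\<close> alone.\<close>
    have "q * d \<le> p * b"
      using M1[of l] Rl Rv U1u l' by (simp add: R_def algebra_simps)
    then have "q * d * count E U2 \<le> p * b * count E U2"
      using U2 by (intro mult_right_mono) auto
    also have "\<dots> = b * (p * count E U2)"
      by simp
    also have "\<dots> \<le> b * (q * count E (U2 - {u2}))"
      using pq pos by (intro mult_left_mono) auto
    finally have "q * (d * count E U2) \<le> q * (b * count E (U2 - {u2}))"
      by (simp add: mult.assoc mult.left_commute)
    then have db: "d * count E U2 \<le> b * count E (U2 - {u2})"
      using q by simp
    have "d * (a + d) * count E (U2 - {u2}) = d * (count E U1 * count E (U2 - {u2}))"
      by (simp add: U1)
    also have "\<dots> \<le> d * (count E U2 * (b + e))"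
      using le pos U1u by (intro mult_left_mono) auto
    also have "\<dots> = d * count E U2 * (b + e)"
      by simp
    also have "\<dots> \<le> b * count E (U2 - {u2}) * (b + e)"
      using db pos count_pos[of "G - {u1} - {c}" E] finG by (intro mult_right_mono) (auto simp: e_def)
    finally have "d * (a + d) * count E (U2 - {u2}) \<le> b * (b + e) * count E (U2 - {u2})"
      by (simp add: mult.assoc mult.commute mult.left_commute)
    then have main: "d * (a + d) \<le> b * (b + e)"
      using U2 by simp
    have c1': "edge_cut E U1 (P \<union> U3) u1 v"
      using edge_cut_sym[OF edge_cut_swap(1)[of E P U1 U3 v u3 u1]] c3 c1 by (simp add: R_def)
    have M2: "count_at E U1 z \<le> count_at E U1 u1" if "z \<in> U1" "essential E U1 z = essential E U1 u1" for z
      using extremal_move_left[OF ext _ c1' that(1)] that(2) V by (auto simp: P_def)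
    have U1u': "count_at E U1 u1 = a + d - (b + e)"
      by (simp add: count_at_def U1 U1u)
    show False
    proof (cases "c = u1")
      \<comment> \<open>Now \<open>main\<close> reads b (a + b) \<le> 2 b^2, against b < a.\<close>
      case True
      then have "d = b" "e = b"
        by (simp_all add: d_def b_def e_def)
      moreover have "b < a"
        using count_Diff_less[of G u1 E] finG inG D1 by (simp add: a_def b_def)
      ultimately show False
        using main pos by simp
    next
      case False
      show False
        using lc
      proof
        assume n: "\<not> essential E U1 u1 \<and> (c = u1 \<or> {u1, c} \<notin> E)"
        have "\<not> essential E U1 c"
          using pendant_not_essential[OF D1(2) l(1)] .
        then have "count_at E U1 c \<le> count_at E U1 u1"
          using n l' by (intro M2) auto
        then have "b + e \<le> 2 * d"
          unfolding U1u' by (simp add: count_at_def U1 U1c)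
        moreover have "b + d < a + e"
          unfolding a_def b_def d_def e_def using finG inG n False D1 loop by (intro count_pair_pos) auto
        ultimately show False
          using leaf_arith1[OF main] pos by simp
      next
        assume s: "essential E U1 u1 \<and> essential E U1 l"
        then have "count_at E U1 l \<le> count_at E U1 u1"
          using l' by (intro M2) auto
        then have "b + e \<le> a"
          unfolding U1u' by (simp add: count_at_def U1 a_def G_def)
        moreover have "b \<le> 2 * e" "a \<le> 2 * d"
          using count_le_twice[of "G - {u1}" E c] count_le_twice[of G E c] finG
          by (simp_all add: a_def b_def d_def e_def)
        ultimately show False
          using leaf_arith2[OF main] pos by simp
      qed
    qed
  qed
qed

lemma extremal_branch_essential:
  assumes ext: "extremal_tree (V, E)" and V: "V = A \<union> B" and c3: "edge_cut E A B v u3"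
    and u: "u1 \<in> V" "u2 \<in> V" "{v, u1} \<in> E" "{v, u2} \<in> E" "u1 \<noteq> u2" "u1 \<noteq> u3" "u2 \<noteq> u3"
  shows "essential E B u3"
proof (rule ccontr)
  assume u3: "\<not> essential E B u3"
  note D3 = edge_cutD[OF c3]
  have "u1 \<in> A" "u2 \<in> A"
    using edge_cut_cross[OF c3 D3(6)] u V by blast+
  obtain P U1 where P: "A = P \<union> U1" and c1: "edge_cut E P U1 v u1"
    using tree_on_cut[OF D3(1,6) \<open>u1 \<in> A\<close> u(3)] .
  note D1 = edge_cutD[OF c1]
  have "u2 \<in> P"
    using edge_cut_cross[OF c1 D1(6)] u P \<open>u2 \<in> A\<close> by blast
  obtain N U2 where N: "P = N \<union> U2" and c2: "edge_cut E N U2 v u2"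
    using tree_on_cut[OF D1(1,6) \<open>u2 \<in> P\<close> u(4)] .
  have c1': "edge_cut E (N \<union> U2) U1 v u1"
    using c1 N by simp
  have c2': "edge_cut E (N \<union> U1) U2 v u2" "edge_cut E N U1 v u1"
    using edge_cut_swap[OF c1' c2] .
  have A: "A = N \<union> U2 \<union> U1" "A = N \<union> U1 \<union> U2"
    using P N by auto
  show False
  \<comment> \<open>The roles of the two other branches are assigned by comparing their ratios; in
    the second case they are exchanged.\<close>
  proof (cases "count E U1 * count E (U2 - {u2}) \<le> count E U2 * count E (U1 - {u1})")
    case True
    then show False
      using extremal_three_branches[OF ext, of N U2 U1 B v u2 u1 u3] c2 c1' c3 V u3 A(1) by simp
  next
    case False
    then show False
      using extremal_three_branches[OF ext, of N U1 U2 B v u1 u2 u3] c2' c3 V u3 A(2) by (simp add: mult.commute)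
  qed
qed

section \<open>The two shapes of extremal trees\<close>

definition nbrs :: "'a set set \<Rightarrow> 'a set \<Rightarrow> 'a \<Rightarrow> 'a set" where
  "nbrs E W x = {w \<in> W. {x, w} \<in> E}"

lemma finite_nbrs: "finite W \<Longrightarrow> finite (nbrs E W x)"
  by (simp add: nbrs_def)

lemma nbrs_cut:
  assumes "edge_cut E A B x y"
  shows "nbrs E (A \<union> B) x = insert y (nbrs E A x)" "y \<notin> nbrs E A x"
proof -
  note D = edge_cutD[OF assms]
  show "nbrs E (A \<union> B) x = insert y (nbrs E A x)"
    using D edge_cut_cross[OF assms D(6)] unfolding nbrs_def by blast
  show "y \<notin> nbrs E A x"
    using D(10) unfolding nbrs_def by blast
qed

lemma nbrs_cut_other:
  assumes "edge_cut E A B x y" "w \<in> A" "w \<noteq> x"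
  shows "nbrs E (A \<union> B) w = nbrs E A w"
  using edge_cut_cross[OF assms(1,2)] assms(3) unfolding nbrs_def by blast

lemma card_nbrs_cut:
  assumes "edge_cut E A B x y"
  shows "card (nbrs E (A \<union> B) x) = Suc (card (nbrs E A x))"
  using nbrs_cut[OF assms] finite_nbrs[OF edge_cutD(3)[OF assms]] by simp

lemma nbrs_singleton: "{x} \<notin> E \<Longrightarrow> nbrs E {x} x = {}"
  by (auto simp: nbrs_def)

lemma nbrs_empty_imp_singleton:
  assumes "tree_on E W" "x \<in> W" "nbrs E W x = {}"
  shows "W = {x}"
  using tree_on_neighbour[OF assms(1,2)] assms(3) unfolding nbrs_def by blast

lemma three_elements:
  assumes "3 \<le> card S"
  obtains a b c where "a \<in> S" "b \<in> S" "c \<in> S" "a \<noteq> b" "a \<noteq> c" "b \<noteq> c"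
proof -
  obtain T where "T \<subseteq> S" "card T = 3"
    using obtain_subset_with_card_n[OF assms] by metis
  then show ?thesis
    using that unfolding card_3_iff by blast
qed

lemma extremal_tree_on:
  assumes "extremal_tree (V, E)"
  shows "tree_on E V" "\<And>e. e \<in> E \<Longrightarrow> e \<subseteq> V" "\<And>e. e \<in> E \<Longrightarrow> card e = 2"
proof -
  have t: "is_tree (V, E)"
    using assms by (simp add: extremal_tree_def)
  then show "tree_on E V"
    by (rule is_tree_imp_tree_on)
  show "\<And>e. e \<in> E \<Longrightarrow> e \<subseteq> V" "\<And>e. e \<in> E \<Longrightarrow> card e = 2"
    using t by (auto simp: is_tree_def simple_graph_def)
qed

lemma extremal_essential_branch:
  assumes ext: "extremal_tree (V, E)" and V: "V = A \<union> B" and c: "edge_cut E A B v u"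
    and deg: "3 \<le> card (nbrs E V v)"
  shows "essential E B u"
proof -
  have "2 \<le> card (nbrs E A v)"
    using card_nbrs_cut[OF c] deg V by simp
  then obtain u1 u2 where u: "u1 \<in> nbrs E A v" "u2 \<in> nbrs E A v" "u1 \<noteq> u2"
    by (meson card_2_iff' obtain_subset_with_card_n subsetD)
  have "u \<notin> nbrs E A v"
    using nbrs_cut(2)[OF c] .
  then have "u1 \<noteq> u" "u2 \<noteq> u"
    using u by auto
  then show ?thesis
    using extremal_branch_essential[OF ext V c, of u1 u2] u V unfolding nbrs_def by blast
qed

text \<open>By \<open>essential_cut\<close>, for an edge of a tree this means that exactly one of
  its ends is essential in the whole tree.\<close>

definition mixed :: "'a set set \<Rightarrow> 'a set \<Rightarrow> 'a \<Rightarrow> 'a \<Rightarrow> bool" where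
  "mixed E V x y \<longleftrightarrow> (\<exists>A B. V = A \<union> B \<and> edge_cut E A B x y \<and> essential E A x \<noteq> essential E B y)"

lemma mixedI: "V = A \<union> B \<Longrightarrow> edge_cut E A B x y \<Longrightarrow> essential E A x \<noteq> essential E B y \<Longrightarrow> mixed E V x y"
  unfolding mixed_def by blast

lemma mixed_sym: "mixed E V x y \<Longrightarrow> mixed E V y x"
  unfolding mixed_def using edge_cut_sym by (metis Un_commute)

text \<open>At degree at least 3 all branch roots are essential, so \<open>x\<close> loses its
  status in the presence of the branch at \<open>y\<close>, while \<open>z\<close> is essential. At
  degree 2 the status of \<open>x\<close> on either side is opposite to that of the one remaining
  neighbour, and the inequality at \<open>y\<close> passes to \<open>z\<close>.\<close>

lemma mixed_propagate:
  assumes ext: "extremal_tree (V, E)" and m: "mixed E V x y" and z: "{x, z} \<in> E" "z \<in> V"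
  shows "mixed E V x z"
proof (cases "z = y")
  case False
  obtain A B where V: "V = A \<union> B" and c: "edge_cut E A B x y" and ne: "essential E A x \<noteq> essential E B y"
    using m unfolding mixed_def by blast
  note D = edge_cutD[OF c]
  have "z \<in> A"
    using edge_cut_cross[OF c D(6), of z] z V False by blast
  then obtain P Z where A: "A = P \<union> Z" and cz: "edge_cut E P Z x z"
    using tree_on_cut[OF D(1,6)] z by metis
  have c2: "edge_cut E (P \<union> B) Z x z" "edge_cut E P B x y"
    using edge_cut_swap[of E P Z B x y z] c cz A by simp_all
  have V2: "V = (P \<union> B) \<union> Z"
    using V A by auto
  have PB: "essential E (P \<union> B) x \<longleftrightarrow> essential E P x \<and> \<not> essential E B y"
    using essential_cut[OF c2(2)] .
  have PZ: "essential E A x \<longleftrightarrow> essential E P x \<and> \<not> essential E Z z"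
    using essential_cut[OF cz] A by simp
  show ?thesis
  proof (cases "3 \<le> card (nbrs E V x)")
    case True
    have "essential E Z z" "essential E B y"
      using extremal_essential_branch[OF ext V2 c2(1) True] extremal_essential_branch[OF ext V c True] .
    then show ?thesis
      using mixedI[OF V2 c2(1)] PB by blast
  next
    case False
    then have "card (nbrs E A x) \<le> 1"
      using card_nbrs_cut[OF c] V by simp
    then have "card (nbrs E P x) = 0"
      using card_nbrs_cut[OF cz] A by simp
    then have "nbrs E P x = {}"
      using finite_nbrs[OF edge_cutD(3)[OF cz]] by simp
    then have "P = {x}"
      using nbrs_empty_imp_singleton[OF edge_cutD(1,6)[OF cz]] by simp
    then have "essential E P x"
      using essential_singleton[OF D(12)] by simp
    then show ?thesis
      using mixedI[OF V2 c2(1)] PB PZ ne by blast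
  qed
qed (use m in simp)

lemma tree_on_connected:
  assumes "tree_on E V" "S \<subseteq> V" "S \<noteq> {}" "\<And>x y. x \<in> S \<Longrightarrow> y \<in> V \<Longrightarrow> {x, y} \<in> E \<Longrightarrow> y \<in> S"
  shows "S = V"
proof (rule ccontr)
  assume "S \<noteq> V"
  then obtain s t where st: "s \<in> S" "t \<in> V" "t \<notin> S"
    using assms(2,3) by blast
  then have "s \<in> V"
    using assms(2) by blast
  then obtain p where p: "p \<noteq> []" "set p \<subseteq> V" "successively (\<lambda>u v. {u, v} \<in> E) p" "hd p = s" "last p = t"
    using tree_on_path[OF assms(1) _ st(2)] by blast
  have "hd p \<in> S" "last p \<notin> S"
    using st(1,3) p(4,5) by simp_all
  from walk_leaves_set[OF p(3,1) this] show False
  proof (elim exE conjE)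
    fix u v assume "u \<in> S" "v \<notin> S" "v \<in> set p" "{u, v} \<in> E"
    then show False
      using assms(4)[of u v] p(2) by blast
  qed
qed

lemma mixed_all:
  assumes ext: "extremal_tree (V, E)" and m: "mixed E V x y" and z: "{w, z} \<in> E" "w \<in> V" "z \<in> V"
  shows "mixed E V w z"
proof -
  let ?S = "{v \<in> V. \<exists>u. mixed E V v u}"
  obtain A B where "V = A \<union> B" and c: "edge_cut E A B x y"
    using m unfolding mixed_def by blast
  then have "x \<in> V"
    using edge_cutD(6)[OF c] by simp
  have "?S = V"
  proof (rule tree_on_connected)
    show "tree_on E V"
      using extremal_tree_on(1)[OF ext] .
    show "b \<in> ?S" if ab: "a \<in> ?S" "b \<in> V" "{a, b} \<in> E" for a b
    proof -
      obtain u where "mixed E V a u"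
        using ab(1) by blast
      then have "mixed E V b a"
        using mixed_sym[OF mixed_propagate[OF ext _ ab(3,2)]] by simp
      then show ?thesis
        using ab(2) by blast
    qed
    show "?S \<noteq> {}"
      using m \<open>x \<in> V\<close> by blast
  qed blast
  then obtain u where "mixed E V w u"
    using z(2) by blast
  then show ?thesis
    using mixed_propagate[OF ext _ z(1,3)] by blast
qed

text \<open>\<open>D\<close> is the class of the vertices that are not centers.\<close>

definition stars :: "'a set set \<Rightarrow> 'a set \<Rightarrow> 'a set \<Rightarrow> bool" where
  "stars E W D \<longleftrightarrow> (\<forall>x\<in>W. \<forall>y\<in>W. {x, y} \<in> E \<longrightarrow> x \<in> D \<longleftrightarrow> y \<notin> D) \<and>
     (\<forall>y\<in>W. y \<in> D \<longrightarrow> card (nbrs E W y) \<le> 2) \<and> (\<forall>x\<in>W. x \<notin> D \<longrightarrow> 2 \<le> card (nbrs E W x))"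

text \<open>An essential vertex has no branch with essential root, so its degree cannot reach 3. A
  non-essential \<open>x\<close> has a branch with essential root \<open>y\<close>; the edge is
  mixed, so \<open>x\<close> is not essential on the other side either and cannot be alone
  there.\<close>

lemma extremal_stars:
  assumes ext: "extremal_tree (V, E)" and m: "mixed E V x0 y0"
  shows "stars E V {v. essential E V v}"
proof -
  note T = extremal_tree_on[OF ext]
  have alt: "essential E V x \<longleftrightarrow> \<not> essential E V y" if xy: "x \<in> V" "y \<in> V" "{x, y} \<in> E" for x y
  proof -
    obtain A B where V: "V = A \<union> B" and c: "edge_cut E A B x y" and ne: "essential E A x \<noteq> essential E B y"
      using mixed_all[OF ext m xy(3,1,2)] unfolding mixed_def by blast
    have "V = B \<union> A"
      using V by auto
    then show ?thesis
      using essential_cut[OF c] essential_cut[OF edge_cut_sym[OF c]] V ne by metis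
  qed
  have small: "card (nbrs E V y) \<le> 2" if y: "y \<in> V" "essential E V y" for y
  proof (rule ccontr)
    assume "\<not> card (nbrs E V y) \<le> 2"
    then have deg: "3 \<le> card (nbrs E V y)"
      by simp
    then have "nbrs E V y \<noteq> {}"
      by auto
    then obtain u where "u \<in> nbrs E V y"
      by blast
    then have u: "u \<in> V" "{y, u} \<in> E"
      by (simp_all add: nbrs_def)
    obtain A B where V: "V = A \<union> B" and c: "edge_cut E A B y u"
      using tree_on_cut[OF T(1) y(1) u] .
    have "essential E B u"
      using extremal_essential_branch[OF ext V c deg] .
    then show False
      using essential_cut[OF c] V y(2) by simp
  qed
  have large: "2 \<le> card (nbrs E V x)" if x: "x \<in> V" "\<not> essential E V x" for x
  proof -
    obtain A B y where V: "V = A \<union> B" and c: "edge_cut E A B x y" and y: "essential E B y"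
      using not_essential_branch[OF T(1) x] .
    note D = edge_cutD[OF c]
    have "essential E V y"
      using alt[of x y] D V x by blast
    moreover have "V = B \<union> A"
      using V by auto
    ultimately have "\<not> essential E A x"
      using essential_cut[OF edge_cut_sym[OF c]] by simp
    then have "A \<noteq> {x}"
      using essential_singleton[OF D(12)] by auto
    then have "nbrs E A x \<noteq> {}"
      using nbrs_empty_imp_singleton[OF D(1,6)] by blast
    then have "1 \<le> card (nbrs E A x)"
      using finite_nbrs[OF D(3), of E x] by (simp add: Suc_le_eq card_gt_0_iff)
    then show ?thesis
      using card_nbrs_cut[OF c] V by simp
  qed
  show ?thesis
    unfolding stars_def
  proof (intro conjI ballI impI)
    show "x \<in> {v. essential E V v} \<longleftrightarrow> y \<notin> {v. essential E V v}"
      if "x \<in> V" "y \<in> V" "{x, y} \<in> E" for x y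
      using alt[OF that] by simp
  qed (use small large in simp_all)
qed

section \<open>Paths\<close>

lemma path_edges_Cons:
  assumes "p \<noteq> []"
  shows "{{(x # p) ! i, (x # p) ! Suc i} | i. Suc i < length (x # p)}
    = insert {x, hd p} {{p ! i, p ! Suc i} | i. Suc i < length p}" (is "?L = ?R")
proof
  show "?L \<subseteq> ?R"
  proof
    fix e assume "e \<in> ?L"
    then obtain i where i: "e = {(x # p) ! i, (x # p) ! Suc i}" "Suc i < length (x # p)"
      by blast
    then show "e \<in> ?R"
      using assms by (cases i) (auto simp: hd_conv_nth)
  qed
  have "{x, hd p} \<in> ?L"
    using assms by (intro CollectI exI[of _ 0]) (simp add: hd_conv_nth)
  moreover have "{p ! i, p ! Suc i} \<in> ?L" if "Suc i < length p" for i
    using that by (intro CollectI exI[of _ "Suc i"]) simp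
  ultimately show "?R \<subseteq> ?L"
    by blast
qed

lemma edges_cut_singleton:
  assumes c: "edge_cut E {x} B x y" and card2: "\<And>e. e \<in> E \<Longrightarrow> card e = 2"
  shows "{e \<in> E. e \<subseteq> {x} \<union> B} = insert {x, y} {e \<in> E. e \<subseteq> B}"
proof
  note D = edge_cutD[OF c]
  show "insert {x, y} {e \<in> E. e \<subseteq> B} \<subseteq> {e \<in> E. e \<subseteq> {x} \<union> B}"
    using D(7,8) by blast
  show "{e \<in> E. e \<subseteq> {x} \<union> B} \<subseteq> insert {x, y} {e \<in> E. e \<subseteq> B}"
  proof
    fix e assume e: "e \<in> {e \<in> E. e \<subseteq> {x} \<union> B}"
    show "e \<in> insert {x, y} {e \<in> E. e \<subseteq> B}"
    proof (cases "x \<in> e")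
      case True
      moreover obtain a b where "e = {a, b}" "a \<noteq> b"
        using card2 e by (metis (lifting) card_2_iff mem_Collect_eq)
      ultimately obtain b where b: "e = {x, b}" "b \<noteq> x"
        by (metis insert_commute insertE singletonD)
      then have "b \<in> B"
        using e by blast
      then have "b = y"
        using edge_cut_cross[OF c D(6)] e b by blast
      then show ?thesis
        using b by simp
    next
      case False
      then show ?thesis
        using e by blast
    qed
  qed
qed

text \<open>The end vertex is peeled off repeatedly. It is essential exactly when the next end is
  not, so its status records the parity of the number of vertices; this is carried along for the
  parity claim in \<open>extremal_path\<close>.\<close>

lemma bounded_degree_path:
  assumes "tree_on E W" "\<forall>e\<in>E. card e = 2" "x \<in> W" "card (nbrs E W x) \<le> 1"
    "\<forall>w\<in>W. card (nbrs E W w) \<le> 2"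
  shows "\<exists>p. p \<noteq> [] \<and> distinct p \<and> hd p = x \<and> set p = W \<and>
    {e \<in> E. e \<subseteq> W} = {{p ! i, p ! Suc i} | i. Suc i < length p} \<and>
    (essential E W x \<longleftrightarrow> odd (length p)) \<and> Suc (card {e \<in> E. e \<subseteq> W}) = length p"
  using assms
proof (induction "card W" arbitrary: W x rule: less_induct)
  case less
  note loop = tree_on_loopfree[OF less.prems(1,3)]
  show ?case
  proof (cases "W = {x}")
    case True
    have "\<not> e \<subseteq> {x}" if "e \<in> E" for e
      using bspec[OF less.prems(2) that] card_mono[of "{x}" e] by auto
    then have "{e \<in> E. e \<subseteq> W} = {}"
      using True by blast
    then show ?thesis
      using True essential_singleton[OF loop] by (intro exI[of _ "[x]"]) auto
  next
    case False
    obtain A B y where W: "W = A \<union> B" and c: "edge_cut E A B x y"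
      using tree_on_peel[OF less.prems(1,3) False] .
    note D = edge_cutD[OF c]
    have "card (nbrs E A x) = 0"
      using less.prems(4) card_nbrs_cut[OF c] W by simp
    then have "nbrs E A x = {}"
      using finite_nbrs[OF D(3)] by simp
    then have A: "A = {x}"
      using nbrs_empty_imp_singleton[OF D(1,6)] by blast
    have W': "W = B \<union> A"
      using W by auto
    have "card (nbrs E W y) = Suc (card (nbrs E B y))"
      using card_nbrs_cut[OF edge_cut_sym[OF c]] W' by simp
    then have y: "card (nbrs E B y) \<le> 1"
      using bspec[OF less.prems(5), of y] D(7) W by simp
    have w: "\<forall>w\<in>B. card (nbrs E B w) \<le> 2"
    proof
      fix w assume that: "w \<in> B"
      show "card (nbrs E B w) \<le> 2"
      proof (cases "w = y")
        case True
        then show ?thesis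
          using y by simp
      next
        case False
        then show ?thesis
          using nbrs_cut_other[OF edge_cut_sym[OF c] that] bspec[OF less.prems(5), of w] that W' by simp
      qed
    qed
    have "card B < card W"
      using edge_cut_card(2)[OF c] W by simp
    from less.hyps[OF this D(2) less.prems(2) D(7) y w]
    obtain p where p: "p \<noteq> []" "distinct p" "hd p = y" "set p = B"
      "{e \<in> E. e \<subseteq> B} = {{p ! i, p ! Suc i} | i. Suc i < length p}"
      "essential E B y \<longleftrightarrow> odd (length p)" "Suc (card {e \<in> E. e \<subseteq> B}) = length p"
      by (elim exE conjE) (rule that; assumption)
    have edges: "{e \<in> E. e \<subseteq> W} = insert {x, y} {e \<in> E. e \<subseteq> B}"
      unfolding W A
    proof (rule edges_cut_singleton)
      show "edge_cut E {x} B x y"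
        using c unfolding A .
      show "card e = 2" if "e \<in> E" for e
        using bspec[OF less.prems(2) that] .
    qed
    have fin: "finite {e \<in> E. e \<subseteq> B}"
      using finite_subset[of "{e \<in> E. e \<subseteq> B}" "Pow B"] D(4) by blast
    have "{x, y} \<notin> {e \<in> E. e \<subseteq> B}"
      using D(9) by blast
    then have card: "Suc (card {e \<in> E. e \<subseteq> W}) = length (x # p)"
      unfolding edges using fin p(7) by simp
    have ess: "essential E W x \<longleftrightarrow> odd (length (x # p))"
      using essential_cut[OF c] W A essential_singleton[OF loop] p(6) by simp
    have "{e \<in> E. e \<subseteq> W} = {{(x # p) ! i, (x # p) ! Suc i} | i. Suc i < length (x # p)}"
      unfolding path_edges_Cons[OF p(1)] edges p(3) p(5) ..
    moreover have "distinct (x # p)" "set (x # p) = W"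
      using p D(9) W A by auto
    ultimately show ?thesis
      using card ess by (intro exI[of _ "x # p"]) simp
  qed
qed

text \<open>At a vertex \<open>x\<close> of degree 3 or more every branch root is essential. Cutting
  the edge to \<open>u\<close> leaves another branch that makes \<open>x\<close> non-essential, so
  this edge would be mixed.\<close>

lemma extremal_path:
  assumes ext: "extremal_tree (V, E)" and V1: "V \<noteq> {v}" "v \<in> V" and nm: "\<And>x y. \<not> mixed E V x y"
  shows "path_graph (V, E) \<and> odd (card E)"
proof -
  note T = extremal_tree_on[OF ext]
  have deg: "card (nbrs E V x) \<le> 2" if x: "x \<in> V" for x
  proof (rule ccontr)
    assume "\<not> card (nbrs E V x) \<le> 2"
    then have deg: "3 \<le> card (nbrs E V x)"
      by simp
    then obtain u w where uw: "u \<in> nbrs E V x" "w \<in> nbrs E V x" "u \<noteq> w"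
      by (metis three_elements)
    then have u: "u \<in> V" "{x, u} \<in> E" and w: "w \<in> V" "{x, w} \<in> E"
      by (simp_all add: nbrs_def)
    obtain A B where V: "V = A \<union> B" and c: "edge_cut E A B x u"
      using tree_on_cut[OF T(1) x u] .
    note D = edge_cutD[OF c]
    have "w \<in> A"
      using edge_cut_cross[OF c D(6)] w V uw by blast
    obtain P Z where A: "A = P \<union> Z" and cz: "edge_cut E P Z x w"
      using tree_on_cut[OF D(1,6) \<open>w \<in> A\<close> w(2)] .
    have "edge_cut E (P \<union> B) Z x w" "V = (P \<union> B) \<union> Z"
      using edge_cut_swap[of E P Z B x w u] c cz A V edge_cut_swap(1) by auto
    then have "essential E Z w"
      using extremal_essential_branch[OF ext _ _ deg] by blast
    then have "\<not> essential E A x"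
      using essential_cut[OF cz] A by simp
    moreover have "essential E B u"
      using extremal_essential_branch[OF ext V c deg] .
    ultimately show False
      using mixedI[OF V c] nm by blast
  qed
  obtain l c where l: "pendant E V l c"
    using pendant_exists[OF T(1) V1(2,1)] by metis
  then have lV: "l \<in> V"
    by (simp add: pendant_def)
  have "nbrs E V l \<subseteq> {c}"
    using l unfolding pendant_def nbrs_def by blast
  then have l1: "card (nbrs E V l) \<le> 1"
    using card_mono[of "{c}"] by fastforce
  have E2: "\<forall>e\<in>E. card e = 2" and deg2: "\<forall>w\<in>V. card (nbrs E V w) \<le> 2"
    using T(3) deg by auto
  from bounded_degree_path[OF T(1) E2 lV l1 deg2]
  obtain p where p: "p \<noteq> []" "distinct p" "hd p = l" "set p = V"
    "{e \<in> E. e \<subseteq> V} = {{p ! i, p ! Suc i} | i. Suc i < length p}"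
    "essential E V l \<longleftrightarrow> odd (length p)" "Suc (card {e \<in> E. e \<subseteq> V}) = length p"
    by (elim exE conjE) (rule that; assumption)
  have E: "{e \<in> E. e \<subseteq> V} = E"
    using T(2) by blast
  have "V \<noteq> {l}"
    using l tree_on_loopfree[OF T(1) lV] unfolding pendant_def by auto
  then obtain A B y where V: "V = A \<union> B" and c: "edge_cut E A B l y"
    using tree_on_peel[OF T(1) lV] by metis
  \<comment> \<open>An essential \<open>l\<close> would make its edge mixed. A non-essential end
    means an even number of vertices, hence an odd number of edges.\<close>
  have "\<not> essential E V l"
    using essential_cut[OF c] mixedI[OF V c] nm[of l y] V by auto
  then have "odd (card E)"
    using p(6,7) unfolding E by (metis even_Suc)
  moreover have "path_graph (V, E)"
    unfolding path_graph_def using p(1,2,4,5) unfolding E by auto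
  ultimately show ?thesis
    by simp
qed

section \<open>Trees of stars\<close>

text \<open>Deleting \<open>x\<close> separates its branches, and a stable set through
  \<open>x\<close> avoids all their roots. Thus the odds of \<open>x\<close> are a product with one
  factor per branch, the form in which degrees enter the balance argument.\<close>

lemma star_decomposition:
  assumes "tree_on E W" "x \<in> W"
  shows "\<exists>B. (\<forall>u\<in>nbrs E W x. edge_cut E (W - B u) (B u) x u \<and> B u \<subseteq> W) \<and>
    (\<forall>u\<in>nbrs E W x. \<forall>w\<in>nbrs E W x. u \<noteq> w \<longrightarrow> B u \<inter> B w = {}) \<and>
    W = insert x (\<Union>u\<in>nbrs E W x. B u) \<and>
    count E (W - {x}) = (\<Prod>u\<in>nbrs E W x. count E (B u)) \<and>
    count_at E W x = (\<Prod>u\<in>nbrs E W x. count E (B u - {u}))"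
  using assms
proof (induction "card W" arbitrary: W rule: less_induct)
  case less
  note loop = tree_on_loopfree[OF less.prems]
  show ?case
  proof (cases "W = {x}")
    case True
    then show ?thesis
      using nbrs_singleton[OF loop] count_singleton[OF loop] by (simp add: count_at_def)
  next
    case False
    obtain A Z z where W: "W = A \<union> Z" and c: "edge_cut E A Z x z"
      using tree_on_peel[OF less.prems False] .
    note D = edge_cutD[OF c]
    let ?N = "nbrs E A x"
    have N: "nbrs E W x = insert z ?N" "z \<notin> ?N"
      using nbrs_cut[OF c] W by simp_all
    have finN: "finite ?N"
      using finite_nbrs[OF D(3)] .
    have "card A < card W"
      using edge_cut_card(1)[OF c] W by simp
    from less.hyps[OF this D(1,6)]
    obtain B where B: "\<forall>u\<in>?N. edge_cut E (A - B u) (B u) x u \<and> B u \<subseteq> A"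
      "\<forall>u\<in>?N. \<forall>w\<in>?N. u \<noteq> w \<longrightarrow> B u \<inter> B w = {}" "A = insert x (\<Union>u\<in>?N. B u)"
      "count E (A - {x}) = (\<Prod>u\<in>?N. count E (B u))"
      "count_at E A x = (\<Prod>u\<in>?N. count E (B u - {u}))"
      by (elim exE conjE) (rule that; assumption)
    define B' where "B' = B(z := Z)"
    have old: "B' u = B u" if "u \<in> ?N" for u
      using that N(2) by (auto simp: B'_def)
    have new: "B' z = Z"
      by (simp add: B'_def)
    have "W - Z = A"
      using W D(5) by auto
    then have cutz: "edge_cut E (W - B' z) (B' z) x z" "B' z \<subseteq> W"
      using c W by (simp_all add: new)
    have cutu: "edge_cut E (W - B' u) (B' u) x u" "B' u \<subseteq> W" "B' u \<inter> Z = {}" if u: "u \<in> ?N" for u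
    proof -
      have cu: "edge_cut E (A - B u) (B u) x u" and sub: "B u \<subseteq> A"
        using B(1) u by blast+
      have "(A - B u) \<union> B u = A" "W - B u = (A - B u) \<union> Z"
        using sub W D(5) by auto
      then show "edge_cut E (W - B' u) (B' u) x u"
        using edge_cut_swap(1)[OF _ cu, of Z z] c old[OF u] by simp
      show "B' u \<subseteq> W" "B' u \<inter> Z = {}"
        using sub W D(5) old[OF u] by auto
    qed
    have "\<forall>u\<in>nbrs E W x. edge_cut E (W - B' u) (B' u) x u \<and> B' u \<subseteq> W"
      unfolding N(1) using cutz cutu by blast
    moreover have "\<forall>u\<in>nbrs E W x. \<forall>w\<in>nbrs E W x. u \<noteq> w \<longrightarrow> B' u \<inter> B' w = {}"
      unfolding N(1)
    proof (intro ballI impI)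
      fix u w assume uw: "u \<in> insert z ?N" "w \<in> insert z ?N" "u \<noteq> w"
      consider "u = z" "w \<in> ?N" | "w = z" "u \<in> ?N" | "u \<in> ?N" "w \<in> ?N"
        using uw by blast
      then show "B' u \<inter> B' w = {}"
      proof cases
        case 1
        then show ?thesis
          using cutu(3)[of w] new by auto
      next
        case 2
        then show ?thesis
          using cutu(3)[of u] new by auto
      next
        case 3
        then show ?thesis
          using B(2) uw(3) old[of u] old[of w] by simp
      qed
    qed
    moreover have "W = insert x (\<Union>u\<in>nbrs E W x. B' u)"
    proof -
      have "(\<Union>u\<in>?N. B' u) = (\<Union>u\<in>?N. B u)"
        using old by simp
      then show ?thesis
        unfolding N(1) using W B(3) new by auto
    qed
    moreover have "count E (W - {x}) = (\<Prod>u\<in>nbrs E W x. count E (B' u))"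
    proof -
      have "(\<Prod>u\<in>?N. count E (B' u)) = (\<Prod>u\<in>?N. count E (B u))"
        using old by simp
      then show ?thesis
        unfolding N(1) using count_Diff_cut[OF c] W B(4) new finN N(2) by simp
    qed
    moreover have "count_at E W x = (\<Prod>u\<in>nbrs E W x. count E (B' u - {u}))"
    proof -
      have "(\<Prod>u\<in>?N. count E (B' u - {u})) = (\<Prod>u\<in>?N. count E (B u - {u}))"
        using old by simp
      then show ?thesis
        unfolding N(1) using count_at_cut[OF c] W B(5) new finN N(2) by simp
    qed
    ultimately show ?thesis
      by blast
  qed
qed

lemma vertex_degree_nbrs:
  assumes "\<forall>e\<in>E. card e = 2" "x \<in> W"
  shows "vertex_degree (W, {e \<in> E. e \<subseteq> W}) x = card (nbrs E W x)"
proof -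
  have "{e \<in> E. e \<subseteq> W \<and> x \<in> e} = (\<lambda>w. {x, w}) ` nbrs E W x"
  proof
    show "{e \<in> E. e \<subseteq> W \<and> x \<in> e} \<subseteq> (\<lambda>w. {x, w}) ` nbrs E W x"
    proof
      fix e assume e: "e \<in> {e \<in> E. e \<subseteq> W \<and> x \<in> e}"
      then have "card e = 2"
        using assms(1) by blast
      then obtain w where "e = {x, w}"
        using e by (auto simp: card_2_iff)
      then show "e \<in> (\<lambda>w. {x, w}) ` nbrs E W x"
        using e by (auto simp: nbrs_def)
    qed
    show "(\<lambda>w. {x, w}) ` nbrs E W x \<subseteq> {e \<in> E. e \<subseteq> W \<and> x \<in> e}"
      using assms(2) by (auto simp: nbrs_def)
  qed
  moreover have "inj_on (\<lambda>w. {x, w}) (nbrs E W x)"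
    by (rule inj_onI) (auto simp: doubleton_eq_iff)
  ultimately have "card {e \<in> E. e \<subseteq> W \<and> x \<in> e} = card (nbrs E W x)"
    by (simp add: card_image)
  moreover have "{e \<in> {e \<in> E. e \<subseteq> W}. x \<in> e} = {e \<in> E. e \<subseteq> W \<and> x \<in> e}"
    by blast
  ultimately show ?thesis
    by (simp add: vertex_degree_def)
qed

lemma starsD:
  assumes "stars E W D"
  shows "\<And>x y. x \<in> W \<Longrightarrow> y \<in> W \<Longrightarrow> {x, y} \<in> E \<Longrightarrow> x \<in> D \<longleftrightarrow> y \<notin> D"
    "\<And>y. y \<in> W \<Longrightarrow> y \<in> D \<Longrightarrow> card (nbrs E W y) \<le> 2"
    "\<And>x. x \<in> W \<Longrightarrow> x \<notin> D \<Longrightarrow> 2 \<le> card (nbrs E W x)"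
  using assms unfolding stars_def by blast+

text \<open>Only the root of the branch loses an edge, and the root lies in \<open>D\<close>, where
  no lower degree bound is imposed. Centers keep all their neighbours.\<close>

lemma stars_branch:
  assumes s: "stars E W D" and W: "W = A \<union> B" and c: "edge_cut E A B x y" and x: "x \<notin> D"
  shows "stars E B D" "y \<in> D" "card (nbrs E B y) \<le> 1"
    "\<And>w. w \<in> B \<Longrightarrow> w \<notin> D \<Longrightarrow> nbrs E B w = nbrs E W w"
proof -
  note C = edge_cutD[OF c]
  have W': "W = B \<union> A"
    using W by auto
  note c' = edge_cut_sym[OF c]
  show y: "y \<in> D"
    using starsD(1)[OF s, of x y] C W x by blast
  have other: "nbrs E B w = nbrs E W w" if "w \<in> B" "w \<noteq> y" for w
    using nbrs_cut_other[OF c' that] W' by simp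
  then show other': "nbrs E B w = nbrs E W w" if "w \<in> B" "w \<notin> D" for w
    using that y by blast
  have "card (nbrs E W y) \<le> 2"
    using starsD(2)[OF s _ y] C(7) W by blast
  then show cy: "card (nbrs E B y) \<le> 1"
    using card_nbrs_cut[OF c'] W' by simp
  show "stars E B D"
    unfolding stars_def
  proof (intro conjI ballI impI)
    show "p \<in> D \<longleftrightarrow> q \<notin> D" if "p \<in> B" "q \<in> B" "{p, q} \<in> E" for p q
      using starsD(1)[OF s] that W by blast
    show "card (nbrs E B p) \<le> 2" if "p \<in> B" "p \<in> D" for p
    proof (cases "p = y")
      case False
      then show ?thesis
        using other[OF that(1) False] starsD(2)[OF s, of p] that W by simp
    qed (use cy in simp)
    show "2 \<le> card (nbrs E B p)" if "p \<in> B" "p \<notin> D" for p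
      using other'[OF that] starsD(3)[OF s, of p] that W by simp
  qed
qed

lemma edges_star_decomposition:
  assumes W: "W = insert x (\<Union>u\<in>N. B u)" and N: "N = nbrs E W x" and card2: "\<forall>e\<in>E. card e = 2"
    and cut: "\<forall>u\<in>N. edge_cut E (W - B u) (B u) x u \<and> B u \<subseteq> W"
  shows "{e \<in> E. e \<subseteq> W} = (\<Union>u\<in>N. {e \<in> E. e \<subseteq> B u}) \<union> (\<lambda>u. {x, u}) ` N"
proof
  show "(\<Union>u\<in>N. {e \<in> E. e \<subseteq> B u}) \<union> (\<lambda>u. {x, u}) ` N \<subseteq> {e \<in> E. e \<subseteq> W}"
    using cut W unfolding N nbrs_def by blast
  show "{e \<in> E. e \<subseteq> W} \<subseteq> (\<Union>u\<in>N. {e \<in> E. e \<subseteq> B u}) \<union> (\<lambda>u. {x, u}) ` N"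
  proof
    fix e assume e: "e \<in> {e \<in> E. e \<subseteq> W}"
    then have "card e = 2"
      using card2 by blast
    then obtain a b where ab: "e = {a, b}" "a \<noteq> b"
      by (auto simp: card_2_iff)
    have abW: "a \<in> W" "b \<in> W" "{a, b} \<in> E" "{b, a} \<in> E"
      using e ab by (auto simp: insert_commute)
    consider "a = x" | "b = x" | "a \<noteq> x" "b \<noteq> x"
      by blast
    then show "e \<in> (\<Union>u\<in>N. {e \<in> E. e \<subseteq> B u}) \<union> (\<lambda>u. {x, u}) ` N"
    proof cases
      case 1
      then have "b \<in> N"
        using abW unfolding N nbrs_def by blast
      then show ?thesis
        using ab 1 by blast
    next
      case 2
      then have "a \<in> N"
        using abW unfolding N nbrs_def by blast
      then show ?thesis
        using ab 2 insert_commute[of a b "{}"] by auto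
    next
      case 3
      then obtain u where u: "u \<in> N" "b \<in> B u"
        using abW(2) W by blast
      have cu: "edge_cut E (W - B u) (B u) x u"
        using cut u(1) by blast
      have "a \<in> B u"
        using edge_cut_cross[OF cu _ u(2) abW(3)] abW(1) 3 by blast
      then show ?thesis
        using u ab abW by blast
    qed
  qed
qed

text \<open>Any center \<open>x\<close> can serve as the last added vertex: the roots of its
  branches had degree at most 2, so they become leaves once the edge to \<open>x\<close> is
  gone.\<close>

lemma stars_imp_tree_of_stars:
  assumes "tree_on E W" "\<forall>e\<in>E. card e = 2" "stars E W D"
  shows "tree_of_stars (W, {e \<in> E. e \<subseteq> W})"
  using assms
proof (induction "card W" arbitrary: W rule: less_induct)
  case less
  obtain v where v: "v \<in> W"
    using tree_on_nonempty[OF less.prems(1)] by blast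
  show ?case
  proof (cases "W = {v}")
    case True
    have "\<not> e \<subseteq> {v}" if "e \<in> E" for e
      using bspec[OF less.prems(2) that] card_mono[of "{v}" e] by auto
    then have no: "{e \<in> E. e \<subseteq> W} = {}"
      using True by blast
    show ?thesis
      unfolding no unfolding True by (rule tree_of_stars.single)
  next
    case False
    obtain w where w: "w \<in> W" "{v, w} \<in> E"
      using tree_on_neighbour[OF less.prems(1) v False] by blast
    obtain x where x: "x \<in> W" "x \<notin> D"
      using starsD(1)[OF less.prems(3) v w] v w by blast
    define N where "N = nbrs E W x"
    from star_decomposition[OF less.prems(1) x(1), folded N_def]
    obtain B where B: "\<forall>u\<in>N. edge_cut E (W - B u) (B u) x u \<and> B u \<subseteq> W"
      "\<forall>u\<in>N. \<forall>w\<in>N. u \<noteq> w \<longrightarrow> B u \<inter> B w = {}" "W = insert x (\<Union>u\<in>N. B u)"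
      by (elim exE conjE) (rule that; assumption)
    have finN: "finite N"
      using finite_nbrs tree_on_finite[OF less.prems(1)] by (simp add: N_def)
    then obtain h where h: "bij_betw h {..<card N} N"
      using ex_bij_betw_nat_finite[of N] by (auto simp: atLeast0LessThan)
    have hN: "h ` {..<card N} = N" "\<And>i. i < card N \<Longrightarrow> h i \<in> N"
      using h by (auto simp: bij_betw_def)
    have branch: "tree_of_stars (B u, {e \<in> E. e \<subseteq> B u}) \<and> leaf (B u, {e \<in> E. e \<subseteq> B u}) u \<and> x \<notin> B u"
      if u: "u \<in> N" for u
    proof -
      have cu: "edge_cut E (W - B u) (B u) x u" and Wu: "W = (W - B u) \<union> B u"
        using B(1) u by auto
      note C = edge_cutD[OF cu]
      note sb = stars_branch[OF less.prems(3) Wu cu x(2)]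
      have "card (B u) < card W"
        using edge_cut_card(2)[OF cu] Wu by simp
      then have "tree_of_stars (B u, {e \<in> E. e \<subseteq> B u})"
        using less.hyps C(2) less.prems(2) sb(1) by blast
      moreover have "leaf (B u, {e \<in> E. e \<subseteq> B u}) u"
        using vertex_degree_nbrs[OF less.prems(2) C(7)] sb(3) C(7) by (simp add: leaf_def)
      ultimately show ?thesis
        using C(9) by blast
    qed
    define T where "T i = (B (h i), {e \<in> E. e \<subseteq> B (h i)})" for i
    have "tree_of_stars (insert x (\<Union>i<card N. vertices (T i)),
        (\<Union>i<card N. edges (T i)) \<union> (\<lambda>i. {x, h i}) ` {..<card N})"
    proof (rule tree_of_stars.join)
      show "2 \<le> card N"
        using starsD(3)[OF less.prems(3) x] by (simp add: N_def)
      show "\<forall>i<card N. tree_of_stars (T i)" "\<forall>i<card N. leaf (T i) (h i)"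
        using branch hN(2) by (simp_all add: T_def)
      show "\<forall>i<card N. \<forall>j<card N. i \<noteq> j \<longrightarrow> vertices (T i) \<inter> vertices (T j) = {}"
      proof (intro allI impI)
        fix i j assume ij: "i < card N" "j < card N" "i \<noteq> j"
        then have "h i \<noteq> h j"
          using h by (auto simp: bij_betw_def inj_on_def)
        then show "vertices (T i) \<inter> vertices (T j) = {}"
          using B(2) hN(2) ij by (simp add: T_def)
      qed
      show "x \<notin> (\<Union>i<card N. vertices (T i))"
        using branch hN(2) by (auto simp: T_def)
    qed
    moreover have "insert x (\<Union>i<card N. vertices (T i)) = W"
      unfolding B(3) by (subst hN(1)[symmetric]) (simp add: T_def)
    moreover have "(\<Union>i<card N. edges (T i)) \<union> (\<lambda>i. {x, h i}) ` {..<card N} = {e \<in> E. e \<subseteq> W}"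
      unfolding edges_star_decomposition[OF B(3) N_def less.prems(2) B(1)]
      by (subst (2 3) hN(1)[symmetric]) (simp add: T_def image_image)
    ultimately show ?thesis
      by simp
  qed
qed

section \<open>Balance\<close>

lemma stars_walk_parity:
  assumes s: "stars E W D" and "p \<noteq> []" "set p \<subseteq> W" "successively (\<lambda>u v. {u, v} \<in> E) p"
  shows "(hd p \<in> D \<longleftrightarrow> last p \<in> D) \<longleftrightarrow> odd (length p)"
  using assms(2-)
proof (induction p)
  case (Cons x p)
  show ?case
  proof (cases "p = []")
    case False
    then obtain y q where p: "p = y # q"
      by (cases p) auto
    have "x \<in> D \<longleftrightarrow> y \<notin> D"
      using starsD(1)[OF s, of x y] Cons.prems(2,3) unfolding p by auto
    moreover have "(y \<in> D \<longleftrightarrow> last p \<in> D) \<longleftrightarrow> odd (length p)"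
      using Cons.IH[OF False] Cons.prems(2,3) unfolding p by auto
    ultimately show ?thesis
      using False by auto
  qed simp
qed simp

text \<open>Leaves lie in \<open>D\<close>, since vertices outside have degree at least 2, and edges
  alternate between the classes. So a vertex of \<open>D\<close> has even distance to a
  leaf.\<close>

lemma center_not_in_class:
  assumes t: "tree_on E V" and card2: "\<forall>e\<in>E. card e = 2" and sub: "{e \<in> E. e \<subseteq> V} = E"
    and s: "stars E V D" and c: "center (V, E) v"
  shows "v \<in> V" "v \<notin> D"
proof -
  show v: "v \<in> V"
    using c by (simp add: center_def)
  show "v \<notin> D"
  proof
    assume vD: "v \<in> D"
    have "\<exists>l\<in>V. card (nbrs E V l) \<le> 1"
    proof (cases "V = {v}")
      case True
      then show ?thesis
        using nbrs_singleton[OF tree_on_loopfree[OF t v]] by simp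
    next
      case False
      obtain l a where l: "pendant E V l a"
        using pendant_exists[OF t v False] by metis
      then have "nbrs E V l \<subseteq> {a}" "l \<in> V"
        unfolding pendant_def nbrs_def by blast+
      then show ?thesis
        using card_mono[of "{a}" "nbrs E V l"] by auto
    qed
    then obtain l where l: "l \<in> V" "card (nbrs E V l) \<le> 1"
      by blast
    then have "leaf (V, E) l"
      using vertex_degree_nbrs[OF card2 l(1)] sub by (simp add: leaf_def)
    then have odd: "odd (graph_dist (V, E) v l)"
      using c by (simp add: center_def)
    have lD: "l \<in> D"
      using starsD(3)[OF s l(1)] l(2) by fastforce
    have adj: "adjacent (V, E) = (\<lambda>u v. {u, v} \<in> E)"
      by (intro ext) (simp add: adjacent_def)
    let ?P = "\<lambda>n. \<exists>p. walk_between (V, E) v p l \<and> length p = Suc n"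
    from tree_on_path[OF t v l(1)] obtain q where q: "q \<noteq> []" "walk_between (V, E) v q l"
      unfolding walk_between_def walk_def adj fst_conv by blast
    then have "?P (length q - 1)"
      by (intro exI[of _ q]) auto
    then have "?P (graph_dist (V, E) v l)"
      unfolding graph_dist_def by (rule LeastI)
    then obtain p where p: "p \<noteq> []" "set p \<subseteq> V" "successively (\<lambda>u v. {u, v} \<in> E) p" "hd p = v" "last p = l"
      "length p = Suc (graph_dist (V, E) v l)"
      unfolding walk_between_def walk_def adj fst_conv by blast
    then have "odd (length p)"
      using stars_walk_parity[OF s p(1-3)] vD lD by simp
    then show False
      using odd p(6) by simp
  qed
qed

text \<open>The degree bound is waived at the root, because the root of a branch has lost the edge
  to its parent. Outside \<open>D\<close> it still keeps a child, so the statuses alternate upwards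
  from leaves in \<open>D\<close>.\<close>

lemma rooted_essential:
  assumes "tree_on E W" "r \<in> W" "\<forall>x\<in>W. \<forall>y\<in>W. {x, y} \<in> E \<longrightarrow> (x \<in> D \<longleftrightarrow> y \<notin> D)"
    "\<forall>x\<in>W. x \<notin> D \<longrightarrow> x \<noteq> r \<longrightarrow> 2 \<le> card (nbrs E W x)"
  shows "(r \<in> D \<longrightarrow> essential E W r) \<and> (r \<notin> D \<and> W \<noteq> {r} \<longrightarrow> \<not> essential E W r)"
  using assms
proof (induction "card W" arbitrary: W r rule: less_induct)
  case less
  have branch: "(y \<in> D \<longrightarrow> essential E B y) \<and> (y \<notin> D \<longrightarrow> \<not> essential E B y) \<and> (r \<in> D \<longleftrightarrow> y \<notin> D)"
    if W: "W = A \<union> B" and c: "edge_cut E A B r y" for A B y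
  proof -
    note C = edge_cutD[OF c]
    note c' = edge_cut_sym[OF c]
    have W': "W = B \<union> A"
      using W by auto
    have ry: "r \<in> D \<longleftrightarrow> y \<notin> D"
      using less.prems(3) C(6,7,8) W by blast
    have lt: "card B < card W"
      using edge_cut_card(2)[OF c] W by simp
    have alt: "\<forall>x\<in>B. \<forall>y\<in>B. {x, y} \<in> E \<longrightarrow> (x \<in> D \<longleftrightarrow> y \<notin> D)"
      using less.prems(3) W by blast
    have deg: "\<forall>x\<in>B. x \<notin> D \<longrightarrow> x \<noteq> y \<longrightarrow> 2 \<le> card (nbrs E B x)"
    proof (intro ballI impI)
      fix x assume x: "x \<in> B" "x \<notin> D" "x \<noteq> y"
      then have "2 \<le> card (nbrs E W x)"
        using less.prems(4) W C(9) by blast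
      then show "2 \<le> card (nbrs E B x)"
        using nbrs_cut_other[OF c' x(1,3)] W' by simp
    qed
    have "B \<noteq> {y}" if "y \<notin> D"
    proof
      assume B: "B = {y}"
      have "2 \<le> card (nbrs E W y)"
        using less.prems(4) W C(7,11) that by blast
      then have "1 \<le> card (nbrs E B y)"
        using card_nbrs_cut[OF c'] W' by simp
      then show False
        using nbrs_singleton[OF C(13)] B by simp
    qed
    then show ?thesis
      using less.hyps[OF lt C(2,7) alt deg] ry by blast
  qed
  show ?case
  proof (intro conjI impI)
    assume r: "r \<in> D"
    show "essential E W r"
    proof (rule ccontr)
      assume "\<not> essential E W r"
      from not_essential_branch[OF less.prems(1,2) this] obtain A B y where
        "W = A \<union> B" "edge_cut E A B r y" "essential E B y" .
      then show False
        using branch[of A B y] r by blast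
    qed
  next
    assume r: "r \<notin> D \<and> W \<noteq> {r}"
    then obtain A B y where W: "W = A \<union> B" and c: "edge_cut E A B r y"
      using tree_on_peel[OF less.prems(1,2)] by metis
    then have "essential E B y"
      using branch r by blast
    then show "\<not> essential E W r"
      using essential_cut[OF c] W by simp
  qed
qed

section \<open>Bounds for the odds of a center\<close>

lemma count_at_upper:
  assumes "tree_on E W" "x \<in> W" "0 \<le> r"
    and "\<And>A B u. W = A \<union> B \<Longrightarrow> edge_cut E A B x u \<Longrightarrow> count E (B - {u}) \<le> r * count E B"
  shows "count_at E W x \<le> r ^ card (nbrs E W x) * count E (W - {x})"
proof -
  from star_decomposition[OF assms(1,2)] obtain B where
    B: "\<forall>u\<in>nbrs E W x. edge_cut E (W - B u) (B u) x u \<and> B u \<subseteq> W"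
    "count E (W - {x}) = (\<Prod>u\<in>nbrs E W x. count E (B u))"
    "count_at E W x = (\<Prod>u\<in>nbrs E W x. count E (B u - {u}))"
    by (elim exE conjE) (rule that; assumption)
  have "count_at E W x \<le> (\<Prod>u\<in>nbrs E W x. r * count E (B u))"
    unfolding B(3)
  proof (rule prod_mono)
    fix u assume u: "u \<in> nbrs E W x"
    then have c: "edge_cut E (W - B u) (B u) x u" and W: "W = (W - B u) \<union> B u"
      using B(1) by auto
    show "0 \<le> count E (B u - {u}) \<and> count E (B u - {u}) \<le> r * count E (B u)"
      using assms(4)[OF W c] count_pos[of "B u - {u}" E] edge_cutD(4)[OF c] by simp
  qed
  then show ?thesis
    unfolding B(2) by (simp add: prod.distrib)
qed

lemma count_at_lower:
  assumes "tree_on E W" "x \<in> W"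
  shows "count E (W - {x}) \<le> 2 ^ card (nbrs E W x) * count_at E W x"
proof -
  from star_decomposition[OF assms(1,2)] obtain B where
    B: "\<forall>u\<in>nbrs E W x. edge_cut E (W - B u) (B u) x u \<and> B u \<subseteq> W"
    "count E (W - {x}) = (\<Prod>u\<in>nbrs E W x. count E (B u))"
    "count_at E W x = (\<Prod>u\<in>nbrs E W x. count E (B u - {u}))"
    by (elim exE conjE) (rule that; assumption)
  have "count E (W - {x}) \<le> (\<Prod>u\<in>nbrs E W x. 2 * count E (B u - {u}))"
    unfolding B(2)
  proof (rule prod_mono)
    fix u assume u: "u \<in> nbrs E W x"
    then have "edge_cut E (W - B u) (B u) x u"
      using B(1) by blast
    from edge_cutD(4)[OF this] show "0 \<le> count E (B u) \<and> count E (B u) \<le> 2 * count E (B u - {u})"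
      using count_le_twice count_pos[of "B u" E] by simp
  qed
  then show ?thesis
    unfolding B(3) by (simp add: prod.distrib)
qed

text \<open>Let \<open>z\<close> be the neighbour of \<open>w\<close> and Z the rest of the branch.
  Then F(W) = 2 F(Z) - F_z(Z), so the claim amounts to (1 - r) F_z(Z) \<le> (2 r - 1) F(Z - z). As
  \<open>z\<close> has at least \<open>d - 1\<close> further branches, the bound \<open>r\<close>
  for these gives F_z(Z) \<le> r^(d-1) F(Z - z), and the third hypothesis is exactly what closes the
  induction.\<close>

lemma branch_ratio:
  fixes r :: real
  assumes "1 / 2 \<le> r" "r \<le> 1" "(1 - r) * r ^ (d - 1) \<le> 2 * r - 1"
    and "tree_on E W" "w \<in> W" "w \<in> D" "stars E W D" "card (nbrs E W w) \<le> 1"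
    "\<forall>x\<in>W. x \<notin> D \<longrightarrow> d \<le> card (nbrs E W x)"
  shows "count E (W - {w}) \<le> r * count E W"
  using assms(4-)
proof (induction "card W" arbitrary: W w rule: less_induct)
  case less
  note loop = tree_on_loopfree[OF less.prems(1,2)]
  show ?case
  proof (cases "W = {w}")
    case True
    then show ?thesis
      using count_singleton[OF loop] assms(1) by simp
  next
    case False
    obtain A Z z where W: "W = A \<union> Z" and c: "edge_cut E A Z w z"
      using tree_on_peel[OF less.prems(1,2) False] .
    note C = edge_cutD[OF c]
    note c' = edge_cut_sym[OF c]
    have W': "W = Z \<union> A"
      using W by auto
    have "card (nbrs E A w) = 0"
      using less.prems(5) card_nbrs_cut[OF c] W by simp
    then have "nbrs E A w = {}"
      using finite_nbrs[OF C(3)] by simp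
    then have A: "A = {w}"
      using nbrs_empty_imp_singleton[OF C(1,6)] by blast
    have zD: "z \<notin> D"
      using starsD(1)[OF less.prems(4), of w z] C(6,7,8) W less.prems(3) by blast
    define k where "k = card (nbrs E Z z)"
    have "d \<le> card (nbrs E W z)"
      using less.prems(6) zD C(7) W by blast
    then have k: "d - 1 \<le> k"
      using card_nbrs_cut[OF c'] W' by (simp add: k_def)
    have sub: "count E (B - {u}) \<le> r * count E B" if Z: "Z = P \<union> B" and cu: "edge_cut E P B z u" for P B u
    proof -
      have cW: "edge_cut E (P \<union> A) B z u"
        using edge_cut_swap(1)[OF _ cu, of A w] c' Z by simp
      have WB: "W = (P \<union> A) \<union> B"
        using W Z by auto
      note sb = stars_branch[OF less.prems(4) WB cW zD]
      note CB = edge_cutD[OF cW]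
      have deg: "\<forall>x\<in>B. x \<notin> D \<longrightarrow> d \<le> card (nbrs E B x)"
        using sb(4) less.prems(6) WB by auto
      have "card B < card W"
        using edge_cut_card(2)[OF cW] WB by simp
      then show ?thesis
        using less.hyps[OF _ CB(2,7) sb(2,1,3) deg] by blast
    qed
    have pos: "0 < count E (Z - {z})"
      using count_pos[of "Z - {z}" E] C(4) by simp
    have "count_at E Z z \<le> r ^ k * count E (Z - {z})"
      unfolding k_def using sub assms(1) by (intro count_at_upper[OF C(2,7)]) auto
    also have "\<dots> \<le> r ^ (d - 1) * count E (Z - {z})"
      using pos k assms(1,2) by (intro mult_right_mono power_decreasing) auto
    finally have "(1 - r) * count_at E Z z \<le> (1 - r) * (r ^ (d - 1) * count E (Z - {z}))"
      using assms(2) by (intro mult_left_mono) auto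
    also have "\<dots> = (1 - r) * r ^ (d - 1) * count E (Z - {z})"
      by simp
    also have "\<dots> \<le> (2 * r - 1) * count E (Z - {z})"
      using assms(3) pos by (intro mult_right_mono) auto
    finally have key: "(1 - r) * count_at E Z z \<le> (2 * r - 1) * count E (Z - {z})" .
    have Zz: "count E Z = count_at E Z z + count E (Z - {z})"
      by (simp add: count_at_def)
    have "count_at E {w} w = 1"
      using count_singleton[OF loop] by (simp add: count_at_def)
    then have "count E W = 2 * count E Z - count_at E Z z"
      using count_Un_cut[OF c order_refl order_refl] count_singleton[OF loop] unfolding W A by simp
    moreover have "W - {w} = Z"
      using W A C(9) by auto
    ultimately show ?thesis
      using key Zz by (simp add: algebra_simps)
  qed
qed

text \<open>The last condition is the product of the lower bound 2^d at the center of degree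
  \<open>d\<close> and the upper bound r^(d+1) at the other center.\<close>

lemma branch_ratio_exists:
  assumes "2 \<le> d"
  obtains r :: real where "1 / 2 \<le> r" "r \<le> 1" "(1 - r) * r ^ (d - 1) \<le> 2 * r - 1" "2 ^ d * r ^ Suc d < 1"
proof -
  consider "d = 2" | "d = 3" | "d = 4" | "5 \<le> d"
    using assms by linarith
  then show ?thesis
  proof cases
    \<comment> \<open>Little freedom here: the third condition reads r^2 + r \<ge> 1 and the fourth
      4 r^3 < 1, so r lies between about 0.618 and 0.630.\<close>
    case 1
    show ?thesis
      by (rule that[of "5 / 8"]) (simp_all add: 1 power_divide eval_nat_numeral)
  next
    case 2
    show ?thesis
      by (rule that[of "7 / 12"]) (simp_all add: 2 power_divide eval_nat_numeral)
  next
    case 3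
    show ?thesis
      by (rule that[of "11 / 20"]) (simp_all add: 3 power_divide eval_nat_numeral)
  next
    case 4
    \<comment> \<open>Chosen so that (d + 1) e = 1/2. Bernoulli bounds (1 - e)^(d+1) below by 1/2,
      and multiplying by (1 + e)^(d+1) turns this into the upper bound 2 for the latter.\<close>
    define e :: real where "e = 1 / (2 * (real d + 1))"
    have e: "0 < e" "e < 1" "real (Suc d) * e = 1 / 2"
      by (simp_all add: e_def field_simps)
    have "1 - real (Suc d) * e \<le> (1 - e) ^ Suc d"
      using Bernoulli_inequality[of "- e" "Suc d"] e by simp
    then have "1 / 2 \<le> (1 - e) ^ Suc d"
      using e(3) by simp
    then have "(1 + e) ^ Suc d * (1 / 2) \<le> (1 + e) ^ Suc d * (1 - e) ^ Suc d"
      using e by (intro mult_left_mono) auto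
    also have "\<dots> = (1 - e\<^sup>2) ^ Suc d"
      by (subst power_mult_distrib[symmetric]) (simp add: power2_eq_square algebra_simps)
    also have "\<dots> < 1"
      using power_Suc_less_one[of "1 - e\<^sup>2" d] power_Suc_less_one[of e 1] e
      by (simp add: power2_eq_square)
    finally have two: "(1 + e) ^ Suc d < 2"
      by simp
    have "(1 + e) ^ (d - 1) \<le> (1 + e) ^ Suc d"
      using e by (intro power_increasing) auto
    with two have two': "(1 + e) ^ (d - 1) \<le> 2"
      by linarith
    \<comment> \<open>False for \<open>d = 4\<close>, which is why the smaller degrees have
      constants of their own.\<close>
    have "4 * (d + 1) \<le> 2 ^ d"
      using 4
    proof (induction d rule: dec_induct)
      case (step n)
      then show ?case
        by simp
    qed simp
    then have "real (4 * (d + 1)) \<le> real (2 ^ d)"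
      using of_nat_le_iff by blast
    moreover have "(2 :: real) ^ d = 2 * 2 ^ (d - 1)"
      using assms by (cases d) auto
    ultimately have pow: "2 * (real d + 1) \<le> 2 ^ (d - 1)"
      by simp
    show ?thesis
    proof (rule that[of "(1 + e) / 2"])
      show "1 / 2 \<le> (1 + e) / 2" "(1 + e) / 2 \<le> 1"
        using e by simp_all
      have "(1 - (1 + e) / 2) * ((1 + e) / 2) ^ (d - 1) \<le> (1 / 2) * (2 / 2 ^ (d - 1))"
        unfolding power_divide using e two' by (intro mult_mono divide_right_mono) auto
      also have "\<dots> \<le> e"
        unfolding e_def using pow by (simp add: divide_simps)
      also have "e = 2 * ((1 + e) / 2) - 1"
        by (simp add: field_simps)
      finally show "(1 - (1 + e) / 2) * ((1 + e) / 2) ^ (d - 1) \<le> 2 * ((1 + e) / 2) - 1" .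
      show "2 ^ d * ((1 + e) / 2) ^ Suc d < 1"
        using two by (simp add: power_divide)
    qed
  qed
qed

text \<open>The odds that a random stable set contains a center of degree \<open>k\<close> lie between \<open>2 ^ (-k)\<close> and
  \<open>r ^ k\<close>, with \<open>r\<close> only slightly above \<open>1 / 2\<close> when all centers have large degree. Hence moving a
  branch from a center of degree at least \<open>d + 2\<close> to a center of minimum degree \<open>d\<close> pays off.\<close>

lemma extremal_degrees:
  assumes ext: "extremal_tree (V, E)" and s: "stars E V D" and v: "v \<in> V" "v \<notin> D" and u: "u \<in> V" "u \<notin> D"
    and d: "d = card (nbrs E V v)" "\<forall>x\<in>V. x \<notin> D \<longrightarrow> d \<le> card (nbrs E V x)"
  shows "card (nbrs E V u) \<le> d + 1"
proof (rule ccontr)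
  assume "\<not> card (nbrs E V u) \<le> d + 1"
  then have du: "d + 2 \<le> card (nbrs E V u)"
    by simp
  then have uv: "v \<noteq> u"
    using d(1) by auto
  have d2: "2 \<le> d"
    using starsD(3)[OF s v] d(1) by simp
  note T = extremal_tree_on[OF ext]
  from star_decomposition[OF T(1) u(1)] obtain B where
    B: "\<forall>y\<in>nbrs E V u. edge_cut E (V - B y) (B y) u y \<and> B y \<subseteq> V"
    "\<forall>y\<in>nbrs E V u. \<forall>w\<in>nbrs E V u. y \<noteq> w \<longrightarrow> B y \<inter> B w = {}" "V = insert u (\<Union>y\<in>nbrs E V u. B y)"
    by (elim exE conjE) (rule that; assumption)
  \<comment> \<open>The moved branch must not contain \<open>v\<close>, so it is taken at a
    neighbour of \<open>u\<close> other than \<open>y0\<close>.\<close>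
  obtain y0 where y0: "y0 \<in> nbrs E V u" "v \<in> B y0"
    using B(3) v(1) uv by blast
  have "nbrs E V u \<noteq> {y0}"
  proof
    assume "nbrs E V u = {y0}"
    then have "card (nbrs E V u) = 1"
      by simp
    then show False
      using du by simp
  qed
  then obtain y where y: "y \<in> nbrs E V u" "y \<noteq> y0"
    using y0(1) by blast
  define R Y where "R = V - B y" and "Y = B y"
  have c: "edge_cut E R Y u y" and V: "V = R \<union> Y"
    using B(1) y(1) by (auto simp: R_def Y_def)
  have vR: "v \<in> R"
    using B(2) y y0 v(1) unfolding R_def by blast
  note C = edge_cutD[OF c]
  have Ru: "d + 1 \<le> card (nbrs E R u)"
    using card_nbrs_cut[OF c] du V by simp
  have other: "nbrs E R w = nbrs E V w" if "w \<in> R" "w \<noteq> u" for w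
    using nbrs_cut_other[OF c that] V by simp
  \<comment> \<open>After losing one branch \<open>u\<close> still has degree at least
    \<open>d + 1\<close>, so the remaining tree keeps the star conditions with the same
    \<open>d\<close>. In particular neither \<open>u\<close> nor \<open>v\<close> is essential
    there, and the move is admissible.\<close>
  have Rd: "\<forall>x\<in>R. x \<notin> D \<longrightarrow> d \<le> card (nbrs E R x)"
  proof (intro ballI impI)
    fix x assume x: "x \<in> R" "x \<notin> D"
    show "d \<le> card (nbrs E R x)"
    proof (cases "x = u")
      case False
      have "d \<le> card (nbrs E V x)"
        using d(2) x V by blast
      then show ?thesis
        using other[OF x(1) False] by simp
    qed (use Ru in simp)
  qed
  have sR: "stars E R D"
    unfolding stars_def
  proof (intro conjI ballI impI)
    show "p \<in> D \<longleftrightarrow> q \<notin> D" if "p \<in> R" "q \<in> R" "{p, q} \<in> E" for p q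
      using starsD(1)[OF s] that V by blast
    show "card (nbrs E R p) \<le> 2" if "p \<in> R" "p \<in> D" for p
    proof -
      have "p \<noteq> u" "p \<in> V"
        using that u V by auto
      then show ?thesis
        using other[OF that(1)] starsD(2)[OF s _ that(2)] by simp
    qed
    show "2 \<le> card (nbrs E R p)" if "p \<in> R" "p \<notin> D" for p
      using Rd that d2 by fastforce
  qed
  have ness: "\<not> essential E R w" if w: "w \<in> R" "w \<notin> D" for w
  proof -
    have "R \<noteq> {w}"
      using C(6) vR uv by auto
    moreover have "\<forall>x\<in>R. \<forall>y\<in>R. {x, y} \<in> E \<longrightarrow> (x \<in> D \<longleftrightarrow> y \<notin> D)"
      "\<forall>x\<in>R. x \<notin> D \<longrightarrow> x \<noteq> w \<longrightarrow> 2 \<le> card (nbrs E R x)"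
      using sR unfolding stars_def by blast+
    ultimately show ?thesis
      using rooted_essential[OF C(1) w(1)] w(2) by blast
  qed
  have move: "count_at E R v \<le> count_at E R u"
    using extremal_move_left[OF ext V c vR] ness[OF vR v(2)] ness[OF C(6) u(2)] by simp
  obtain r :: real where r: "1 / 2 \<le> r" "r \<le> 1" "(1 - r) * r ^ (d - 1) \<le> 2 * r - 1" "2 ^ d * r ^ Suc d < 1"
    using branch_ratio_exists[OF d2] .
  have ratio: "count E (Q - {t}) \<le> r * count E Q" if R: "R = P \<union> Q" and ct: "edge_cut E P Q u t" for P Q t
  proof -
    note sb = stars_branch[OF sR R ct u(2)]
    note CQ = edge_cutD[OF ct]
    have "\<forall>x\<in>Q. x \<notin> D \<longrightarrow> d \<le> card (nbrs E Q x)"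
      using sb(4) Rd R by auto
    then show ?thesis
      using branch_ratio[OF r(1-3) CQ(2,7) sb(2,1,3)] by blast
  qed
  have posu: "0 < count E (R - {u})"
    using count_pos[of "R - {u}" E] C(3) by simp
  have "count_at E R u \<le> r ^ card (nbrs E R u) * count E (R - {u})"
    using ratio r(1) by (intro count_at_upper[OF C(1,6)]) auto
  also have "\<dots> \<le> r ^ Suc d * count E (R - {u})"
    using posu Ru r(1,2) by (intro mult_right_mono power_decreasing) auto
  finally have upper: "count_at E R u \<le> r ^ Suc d * count E (R - {u})" .
  have "card (nbrs E R v) = d"
    using other[OF vR uv] d(1) by simp
  then have lower: "count E (R - {v}) \<le> 2 ^ d * count_at E R v"
    using count_at_lower[OF C(1) vR] by simp
  have "count E (R - {u}) \<le> count E (R - {v})"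
    using move by (simp add: count_at_def)
  also note lower
  also have "2 ^ d * count_at E R v \<le> 2 ^ d * (r ^ Suc d * count E (R - {u}))"
    using move upper by (intro mult_left_mono) auto
  also have "\<dots> = (2 ^ d * r ^ Suc d) * count E (R - {u})"
    by simp
  also have "\<dots> < 1 * count E (R - {u})"
    using r(4) posu by (intro mult_strict_right_mono)
  finally show False
    by simp
qed

lemma extremal_stars_balanced:
  assumes ext: "extremal_tree (V, E)" and s: "stars E V D"
  shows "balanced_tree_of_stars (V, E)"
proof -
  note T = extremal_tree_on[OF ext]
  have card2: "\<forall>e\<in>E. card e = 2" and sub: "{e \<in> E. e \<subseteq> V} = E"
    using T by blast+
  have "tree_of_stars (V, E)"
    using stars_imp_tree_of_stars[OF T(1) card2 s] unfolding sub .
  moreover have "vertex_degree (V, E) u \<le> vertex_degree (V, E) v + 1"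
    if uv: "center (V, E) u" "center (V, E) v" for u v
  proof -
    note u = center_not_in_class[OF T(1) card2 sub s uv(1)]
    note v = center_not_in_class[OF T(1) card2 sub s uv(2)]
    \<comment> \<open>A center of minimum degree: every other degree is at most one larger, which
      bounds all differences.\<close>
    obtain w where w: "w \<in> V \<and> w \<notin> D" "\<And>x. x \<in> V \<and> x \<notin> D \<Longrightarrow> card (nbrs E V w) \<le> card (nbrs E V x)"
      using ex_has_least_nat[of "\<lambda>x. x \<in> V \<and> x \<notin> D" v "\<lambda>x. card (nbrs E V x)"] v by blast
    have "card (nbrs E V u) \<le> card (nbrs E V w) + 1"
      using extremal_degrees[OF ext s _ _ u refl, of w] w by blast
    also have "card (nbrs E V w) \<le> card (nbrs E V v)"
      using w(2) v by blast
    finally show ?thesis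
      using vertex_degree_nbrs[OF card2 u(1)] vertex_degree_nbrs[OF card2 v(1)] unfolding sub by simp
  qed
  ultimately show ?thesis
    unfolding balanced_tree_of_stars_def by blast
qed

theorem theorem2:
  fixes T :: "'a sgraph"
  assumes "extremal_tree T"
  shows "balanced_tree_of_stars T \<or> (path_graph T \<and> odd (card (edges T)))"
proof -
  obtain V E where T: "T = (V, E)"
    by (cases T)
  have ext: "extremal_tree (V, E)"
    using assms T by simp
  note tree = extremal_tree_on(1)[OF ext]
  obtain v where v: "v \<in> V"
    using tree_on_nonempty[OF tree] by blast
  consider "V = {v}" | x y where "mixed E V x y" | "V \<noteq> {v}" "\<And>x y. \<not> mixed E V x y"
    by blast
  then show ?thesis
  proof cases
    \<comment> \<open>Without edges neither alternative about mixed edges says anything; the vertex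
      itself forms the class \<open>D\<close>, and no centers remain to be checked.\<close>
    case 1
    then have "stars E V {v}"
      using tree_on_loopfree[OF tree v] nbrs_singleton[of v E] unfolding stars_def by auto
    then show ?thesis
      using extremal_stars_balanced[OF ext] T by blast
  next
    case 2
    then show ?thesis
      using extremal_stars_balanced[OF ext extremal_stars[OF ext]] T by blast
  next
    case 3
    then show ?thesis
      using extremal_path[OF ext _ v] T by simp
  qed
qed

end
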